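(* Let $w(z;\rho)$ be a regular semi-classical weight with singularities $z_0=0,z_1,\dots,z_M$ and exponents $\rho=(\rho_0,\dots,\rho_M)$, let $j$ be such that $z_j\ne0$, and denote by $Y_n(z;\rho_j\pm1)$, $K_n(z;\rho_j\pm1)$ the matrices $Y_n,K_n$ for the weight $(z-z_j)^{\pm1}w(z;\rho)$. Let $R^{j\pm}_n(z;\rho_j)$ be the Schlesinger transformation matrices, with $Y_n(z;\rho_j\pm1)=R^{j\pm}_n(z;\rho_j)Y_n(z;\rho_j)$, whose explicit forms are given in the context. Then $$R^{j\pm}_{n+1}(z;\rho_j)\,K_n(z;\rho_j)=K_n(z;\rho_j\pm1)\,R^{j\pm}_n(z;\rho_j)$$ (for $n\ge0$ in the $+$ case and $n\ge1$ in the $-$ case).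
   Context: $\mathbb T$ is the unit circle. For a complex-valued weight $w$ on $\mathbb T$ put $w_k=\int_{\mathbb T}\frac{d\zeta}{2\pi i\zeta}w(\zeta)\zeta^{-k}$ and $I_n[w]=\det[w_{j-k}]_{j,k=0,\dots,n-1}$, $I_0=1$. If $I_n[w]\ne0$ for all $n\ge0$, the bi-orthogonal system of $w$ is: polynomials $\phi_n,\bar\phi_n$ of degree $n$ with the same leading coefficient $\kappa_n$ satisfying $\int_{\mathbb T}\frac{d\zeta}{2\pi i\zeta}w(\zeta)\phi_m(\zeta)\bar\phi_n(\bar\zeta)=\delta_{m,n}$ with $\bar\zeta=1/\zeta$ ($\bar\phi_n$ is a separate polynomial, not in general the complex conjugate of $\phi_n$; $\kappa_n^2=I_n/I_{n+1}$, with a choice of square root $\kappa_n$ fixed for each weight); $\phi^*_n(z)=z^n\bar\phi_n(1/z)$; and the associated functions, for $z\notin\mathbb T$ and $n>0$, $\xi_n(z)=\int_{\mathbb T}\frac{d\zeta}{2\pi i\zeta}\frac{\zeta+z}{\zeta-z}w(\zeta)\phi_n(\zeta)$, $\ \xi^*_n(z)=-z^n\int_{\mathbb T}\frac{d\zeta}{2\pi i\zeta}\frac{\zeta+z}{\zeta-z}w(\zeta)\bar\phi_n(\bar\zeta)$, and $\xi_0(z)=\kappa_0[w_0+F(z)]$, $\xi^*_0(z)=\kappa_0[w_0-F(z)]$ with $F(z)=\int_{\mathbb T}\frac{d\zeta}{2\pi i\zeta}\frac{\zeta+z}{\zeta-z}w(\zeta)$. Put $$Y_n(z)=\begin{pmatrix}\phi_n(z)&\xi_n(z)/w(z)\\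 \phi^*_n(z)&-\xi^*_n(z)/w(z)\end{pmatrix},\qquad K_n(z)=\frac1{\kappa_n}\begin{pmatrix}\kappa_{n+1}z&\phi_{n+1}(0)\\ \bar\phi_{n+1}(0)z&\kappa_{n+1}\end{pmatrix};$$ it is a classical fact that $Y_{n+1}=K_nY_n$ for $n\ge0$. Regular semi-classical weights: $M\ge1$, $z_0=0,z_1,\dots,z_M$ are distinct points of $\mathbb C$, and $\frac{w'(z)}{w(z)}=\frac{2V(z)}{W(z)}=\sum_{j=0}^M\frac{\rho_j}{z-z_j}$ with $W(z)=\prod_{j=0}^M(z-z_j)$, $\deg V<M+1$, $\rho_j\in\mathbb C\setminus\mathbb Z_{\ge0}$; e.g. $w(z)=\prod_{j=0}^M(z-z_j)^{\rho_j}$, possibly with different constant factors on different arcs of $\mathbb T$. Exponents are restricted so that the trigonometric moments of all weights considered exist. Values $\xi_n(z_j),\xi^*_n(z_j)$ at a singular point on $\mathbb T$ are understood as limits. The bi-orthogonal systems of $w$ and of all shifted weights considered are assumed to exist, with $r_n\bar r_n\ne0,1$ for $n\ge1$, where $r_n=\phi_n(0)/\kappa_n$, $\bar r_n=\bar\phi_n(0)/\kappa_n$. Schlesinger matrices ($\kappa_n^\pm$ is the leading coefficient for $(z-z_j)^{\pm1}w$; $\phi_n(z_j)\ne0$ for all $n\ge0$ is assumed in the $+$ case, $\xi^*_n(z_j)\neq0$ for all $n\ge0$ in the $-$ case): $$R^{j+}_n=\frac{1}{z-z_j}\frac{\kappa^+_n}{\kappa_n}\begin{pmatrix} z-\frac{\kappa_n\phi_{n+1}(z_j)}{\kappa_{n+1}\phi_n(z_j)}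 & \frac{\phi_{n+1}(0)}{\kappa_{n+1}}\\ \frac{\phi^*_n(z_j)}{\phi_n(z_j)}z & -z_j\end{pmatrix},\quad R^{j-}_n=\frac{\kappa^-_n}{\kappa_n}\begin{pmatrix}\frac{\kappa_n\xi^*_n(z_j)}{\kappa_{n-1}\xi^*_{n-1}(z_j)} & \frac{\kappa_n\xi_n(z_j)}{\kappa_{n-1}\xi^*_{n-1}(z_j)}\\ \frac{\bar\phi_n(0)\xi^*_n(z_j)}{\kappa_{n-1}\xi^*_{n-1}(z_j)}\frac{z}{z_j} & 1-\frac{\kappa_n\xi^*_n(z_j)}{\kappa_{n-1}\xi^*_{n-1}(z_j)}\frac{z}{z_j}\end{pmatrix}.$$ *)

theory Defs
  imports "HOL-Complex_Analysis.Contour_Integration" "Jordan_Normal_Form.Determinant"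
begin

text \<open>The integral of $f$ over the unit circle against $d\zeta / (2\pi i \zeta)$.\<close>

definition circle_int :: "(complex \<Rightarrow> complex) \<Rightarrow> complex" where
  "circle_int f = contour_integral (circlepath 0 1) (\<lambda>\<zeta>. f \<zeta> / (2 * of_real pi * \<i> * \<zeta>))"

definition moment :: "(complex \<Rightarrow> complex) \<Rightarrow> int \<Rightarrow> complex" where
  "moment w k = circle_int (\<lambda>\<zeta>. w \<zeta> * \<zeta> powi (- k))"

text \<open>Absolute integrability of $w$ on the circle, which is equivalent to the existence of all
  trigonometric moments as Lebesgue integrals.\<close>

definition moments_exist :: "(complex \<Rightarrow> complex) \<Rightarrow> bool" where
  "moments_exist w \<longleftrightarrow> (\<lambda>t. w (circlepath 0 1 t)) absolutely_integrable_on {0..1}"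

definition toeplitz_det :: "(complex \<Rightarrow> complex) \<Rightarrow> nat \<Rightarrow> complex" where
  "toeplitz_det w n = Determinant.det (Matrix.mat n n (\<lambda>(j, k). moment w (int j - int k)))"

text \<open>Here \<open>\<phi>b n\<close> is the polynomial $\bar\phi_n$, which is not the complex conjugate
  of \<open>\<phi> n\<close>. The sequence \<open>\<kappa>\<close> is a parameter because $w$ determines each
  $\kappa_n$ only up to sign.\<close>

definition biorthogonal_system ::
  "(complex \<Rightarrow> complex) \<Rightarrow> (nat \<Rightarrow> complex) \<Rightarrow> (nat \<Rightarrow> complex poly) \<Rightarrow> (nat \<Rightarrow> complex poly) \<Rightarrow> bool"
where
  "biorthogonal_system w \<kappa> \<phi> \<phi>b \<longleftrightarrow>
     moments_exist w \<and>
     (\<forall>n. toeplitz_det w n \<noteq> 0) \<and>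
     (\<forall>n. degree (\<phi> n) = n \<and> lead_coeff (\<phi> n) = \<kappa> n \<and>
          degree (\<phi>b n) = n \<and> lead_coeff (\<phi>b n) = \<kappa> n) \<and>
     (\<forall>m n. circle_int (\<lambda>\<zeta>. w \<zeta> * poly (\<phi> m) \<zeta> * poly (\<phi>b n) (1 / \<zeta>)) = (if m = n then 1 else 0))"

text \<open>The condition $r_n \bar r_n \notin \{0, 1\}$ for $n \ge 1$.\<close>

definition nondegenerate ::
  "(nat \<Rightarrow> complex) \<Rightarrow> (nat \<Rightarrow> complex poly) \<Rightarrow> (nat \<Rightarrow> complex poly) \<Rightarrow> bool" where
  "nondegenerate \<kappa> \<phi> \<phi>b \<longleftrightarrow>
     (\<forall>n\<ge>1. let rr = (poly (\<phi> n) 0 / \<kappa> n) * (poly (\<phi>b n) 0 / \<kappa> n) in rr \<noteq> 0 \<and> rr \<noteq> 1)"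

text \<open>The formula represents the polynomial $\phi^*_n$ only for $z \ne 0$.\<close>

definition phi_star :: "(nat \<Rightarrow> complex poly) \<Rightarrow> nat \<Rightarrow> complex \<Rightarrow> complex" where
  "phi_star \<phi>b n z = z ^ n * poly (\<phi>b n) (1 / z)"

definition caratheodory :: "(complex \<Rightarrow> complex) \<Rightarrow> complex \<Rightarrow> complex" where
  "caratheodory w z = circle_int (\<lambda>\<zeta>. (\<zeta> + z) / (\<zeta> - z) * w \<zeta>)"

definition xi ::
  "(complex \<Rightarrow> complex) \<Rightarrow> (nat \<Rightarrow> complex) \<Rightarrow> (nat \<Rightarrow> complex poly) \<Rightarrow> nat \<Rightarrow> complex \<Rightarrow> complex" where
  "xi w \<kappa> \<phi> n z =
     (if n = 0 then \<kappa> 0 * (moment w 0 + caratheodory w z)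
      else circle_int (\<lambda>\<zeta>. (\<zeta> + z) / (\<zeta> - z) * w \<zeta> * poly (\<phi> n) \<zeta>))"

definition xi_star ::
  "(complex \<Rightarrow> complex) \<Rightarrow> (nat \<Rightarrow> complex) \<Rightarrow> (nat \<Rightarrow> complex poly) \<Rightarrow> nat \<Rightarrow> complex \<Rightarrow> complex" where
  "xi_star w \<kappa> \<phi>b n z =
     (if n = 0 then \<kappa> 0 * (moment w 0 - caratheodory w z)
      else - (z ^ n) * circle_int (\<lambda>\<zeta>. (\<zeta> + z) / (\<zeta> - z) * w \<zeta> * poly (\<phi>b n) (1 / \<zeta>)))"

text \<open>The associated functions are defined off the unit circle; at a point of the circle the
  value is the limit through points off the circle.\<close>

definition circle_value :: "(complex \<Rightarrow> complex) \<Rightarrow> complex \<Rightarrow> complex" where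
  "circle_value f a = (if a \<in> sphere 0 1 then Lim (at a within - sphere 0 1) f else f a)"

text \<open>The derivative in $w' / w = 2V / W$ is taken along the circle. The finite set \<open>E\<close>
  contains the endpoints of arcs on which $w$ carries different constant factors. The equation is
  written as $w' = (2V / W) w$, so that the factor of an arc may be $0$.\<close>

definition regular_semiclassical ::
  "nat \<Rightarrow> (nat \<Rightarrow> complex) \<Rightarrow> (nat \<Rightarrow> complex) \<Rightarrow> (complex \<Rightarrow> complex) \<Rightarrow> bool" where
  "regular_semiclassical M s \<rho> w \<longleftrightarrow>
     M \<ge> 1 \<and> s 0 = 0 \<and> inj_on s {..M} \<and> (\<forall>i\<le>M. \<rho> i \<notin> \<nat>) \<and>
     (\<exists>V W :: complex poly.
        W = (\<Prod>i\<le>M. [:- s i, 1:]) \<and> degree V < M + 1 \<and>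
        (\<forall>z. z \<notin> s ` {..M} \<longrightarrow> 2 * poly V z / poly W z = (\<Sum>i\<le>M. \<rho> i / (z - s i))) \<and>
        (\<exists>E. finite E \<and>
           (\<forall>\<zeta> \<in> sphere 0 1 - (E \<union> s ` {..M}).
              (w has_field_derivative 2 * poly V \<zeta> / poly W \<zeta> * w \<zeta>) (at \<zeta> within sphere 0 1))))"

definition mat2 :: "complex \<Rightarrow> complex \<Rightarrow> complex \<Rightarrow> complex \<Rightarrow> complex mat" where
  "mat2 a b c d = mat_of_rows_list 2 [[a, b], [c, d]]"

definition K_matrix ::
  "(nat \<Rightarrow> complex) \<Rightarrow> (nat \<Rightarrow> complex poly) \<Rightarrow> (nat \<Rightarrow> complex poly) \<Rightarrow> nat \<Rightarrow> complex \<Rightarrow> complex mat" where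
  "K_matrix \<kappa> \<phi> \<phi>b n z = (1 / \<kappa> n) \<cdot>\<^sub>m
     mat2 (\<kappa> (n+1) * z)             (poly (\<phi> (n+1)) 0)
          (poly (\<phi>b (n+1)) 0 * z)   (\<kappa> (n+1))"

text \<open>In both Schlesinger matrices \<open>a\<close> is the singularity $z_j$ and \<open>\<kappa>'\<close> is the sequence of
  leading coefficients for the shifted weight; the remaining data belong to $w$.\<close>

definition R_plus ::
  "complex \<Rightarrow> (nat \<Rightarrow> complex) \<Rightarrow> (nat \<Rightarrow> complex) \<Rightarrow> (nat \<Rightarrow> complex poly) \<Rightarrow> (nat \<Rightarrow> complex poly)
     \<Rightarrow> nat \<Rightarrow> complex \<Rightarrow> complex mat" where
  "R_plus a \<kappa>' \<kappa> \<phi> \<phi>b n z = (1 / (z - a) * (\<kappa>' n / \<kappa> n)) \<cdot>\<^sub>m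
     mat2 (z - \<kappa> n * poly (\<phi> (n+1)) a / (\<kappa> (n+1) * poly (\<phi> n) a))   (poly (\<phi> (n+1)) 0 / \<kappa> (n+1))
          (phi_star \<phi>b n a / poly (\<phi> n) a * z)                      (- a)"

text \<open>Meaningful for $n \ge 1$ only, because of the index $n - 1$.\<close>

definition R_minus ::
  "(complex \<Rightarrow> complex) \<Rightarrow> complex \<Rightarrow> (nat \<Rightarrow> complex) \<Rightarrow> (nat \<Rightarrow> complex) \<Rightarrow> (nat \<Rightarrow> complex poly)
     \<Rightarrow> (nat \<Rightarrow> complex poly) \<Rightarrow> nat \<Rightarrow> complex \<Rightarrow> complex mat" where
  "R_minus w a \<kappa>' \<kappa> \<phi> \<phi>b n z =
    (let X  = (\<lambda>m. circle_value (xi w \<kappa> \<phi> m) a);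
         X' = (\<lambda>m. circle_value (xi_star w \<kappa> \<phi>b m) a);
         d  = \<kappa> (n-1) * X' (n-1)
     in (\<kappa>' n / \<kappa> n) \<cdot>\<^sub>m
        mat2 (\<kappa> n * X' n / d)                              (\<kappa> n * X n / d)
             (poly (\<phi>b n) 0 * X' n / d * (z / a))          (1 - \<kappa> n * X' n / d * (z / a)))"

end

theory Submission
  imports Defs "HOL-Complex_Analysis.Cauchy_Integral_Formula" "HOL-Real_Asymp.Real_Asymp"
begin

text \<open>Both compatibility relations are obtained directly, without \<open>Y\<^sub>n\<close>: entrywise they are polynomial
  identities between the reflection coefficients of the two weights. For \<open>(z - z\<^sub>j) w\<close> the
  polynomials \<open>(z - z\<^sub>j) \<phi>\<^sub>n\<^sup>+\<close> and \<open>(z - z\<^sub>j) \<phi>\<^sub>n\<^sup>+\<^sup>*\<close> satisfy enough orthogonality relations for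
  \<open>w\<close> to be combinations of two polynomials of the system of \<open>w\<close> (Christoffel), and evaluation at
  \<open>z\<^sub>j\<close> gives the coefficients. Interchanging the two weights expresses the system of
  \<open>w / (z - z\<^sub>j)\<close> through that of \<open>w\<close> (Geronimus), with coefficients given by the integrals of
  \<open>\<phi>\<^sub>n\<close> and \<open>\<phi>\<^sub>n\<^sup>*\<close> against \<open>w / (z - z\<^sub>j)\<close>, that is, by \<open>\<xi>\<^sub>n(z\<^sub>j)\<close> and \<open>\<xi>\<^sub>n\<^sup>*(z\<^sub>j)\<close>.

  For \<open>z\<^sub>j\<close> on the circle this last step needs the limits that define \<open>\<xi>\<^sub>n(z\<^sub>j)\<close> to exist even
  under tangential approach. On either side of \<open>z\<^sub>j\<close> the differential equation makes \<open>\<bar>w\<bar>\<close> comparable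
  to a power of the distance to \<open>z\<^sub>j\<close>, with a positive exponent because \<open>w / (z - z\<^sub>j)\<close> is integrable. Hence \<open>w\<close> is
  Hoelder continuous at \<open>z\<^sub>j\<close> with value \<open>0\<close>, so that its Cauchy integral is continuous there.\<close>

section \<open>Bi-orthogonal polynomials of a moment functional\<close>

text \<open>Two conventions of the logic shape the analytic half. \<open>Lim\<close> has an
  arbitrary value where no limit exists, so for z_j on the circle the entries of
  \<open>R_minus\<close> carry no information until convergence is proved. And
  \<open>inverse 0 = 0\<close> makes (z - z_j) * inverse (z - z_j) * w differ from w at z_j, where w
  is arbitrary anyway; integrands are therefore compared up to one point. On the algebraic side a
  single setting serves both shifts: \<open>christoffel\<close> couples a functional
  \<open>L\<close> with the functional \<open>L'\<close> of z - a times its weight. The given weight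
  is \<open>L\<close> in the + case and \<open>L'\<close> in the - case. The monic normalisation
  removes the square roots \<kappa>_n: they survive only in scalar prefactors, which agree on both
  sides, and in \<kappa>_n^2 / \<kappa>_{n+1}^2 = 1 - r rb at index n + 1. Comparing powers of z in
  each entry then leaves a few relations free of z.\<close>

lemma christoffel_scalar:
  fixes a :: "'a::field"
  assumes "a \<noteq> 0" and "r' - \<alpha>' * r = - a * sr" and "\<beta>' * \<alpha> = \<beta> + a * rb"
    and "\<alpha> = a + r * \<beta>" and "\<alpha>' = a + r' * \<beta>'"
  shows "r' * rb - \<alpha>' = sr * \<beta> - \<alpha>"
proof -
  \<comment> \<open>The factor \<open>a\<close> allows the hypotheses to replace
    \<open>a * rb\<close> and \<open>a * sr\<close>; the remaining terms collapse to \<alpha> (a +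
    r' \<beta>' - \<alpha>'). Primes mark the next index, and \<open>sr\<close> belongs to the
    multiplied weight.\<close>
  have "a * (r' * rb - \<alpha>' - (sr * \<beta> - \<alpha>)) = 0" using assms(2-) by Groebner_Basis.algebra
  with assms(1) show ?thesis by simp
qed

text \<open>\<open>p\<close> and \<open>q\<close> are, up to a scalar, the first row of
  \<open>R_minus\<close>; letters with \<open>s\<close> belong to the given weight, the others to
  the weight divided by z - a, and primes raise the index. Clearing 1 - sr sb or \<open>a\<close>
  turns each conclusion into a polynomial consequence of the hypotheses.\<close>

lemma geronimus_scalar:
  fixes a :: "'a::field"
  assumes nz: "a \<noteq> 0" "1 - sr * sb \<noteq> 0"
    and p: "p * (1 - sr * sb) = 1 - sb * r" and q: "q * (1 - sr * sb) = r - sr"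
    and p': "p' * (1 - sr' * sb') = 1 - sb' * r'" and pq: "a * q = r' * p"
    and rb': "a * rb' = a * sb' - (1 - sb' * r') * sb"
  shows "p + sb * q = 1" and "p * sr + q = r" and "a * sb' = p * (a * rb' + sb)"
    and "p' * (sb' * sr' - 1) = rb' * a * q - p"
proof -
  have "(p + sb * q - 1) * (1 - sr * sb) = 0" using p q by Groebner_Basis.algebra
  with nz show 1: "p + sb * q = 1" by simp
  have "(p * sr + q - r) * (1 - sr * sb) = 0" using p q by Groebner_Basis.algebra
  with nz show "p * sr + q = r" by simp
  show 3: "a * sb' = p * (a * rb' + sb)" using rb' pq 1 by Groebner_Basis.algebra
  have "a * (p' * (sb' * sr' - 1) - (rb' * a * q - p)) = 0" using p' pq 1 3 by Groebner_Basis.algebra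
  with nz show "p' * (sb' * sr' - 1) = rb' * a * q - p" by simp
qed

text \<open>\<open>L k p\<close> stands for the integral of \<open>\<zeta>\<^sup>k p(\<zeta>)\<close> against the weight.\<close>

locale moment_functional =
  fixes L :: "int \<Rightarrow> 'a::field poly \<Rightarrow> 'a"
  assumes L_add: "L k (p + q) = L k p + L k q"
    and L_smult: "L k (Polynomial.smult c p) = c * L k p"
    and L_shift: "L k (pCons 0 p) = L (k + 1) p"
begin

lemma L_minus: "L k (p - q) = L k p - L k q"
  using L_add[of k "p - q" q] by simp

lemmas L_simps = L_add L_minus L_smult L_shift

end

text \<open>\<open>\<Phi> n\<close> is the monic \<open>\<phi>\<^sub>n\<close> and \<open>\<Psi> n\<close> is \<open>\<phi>\<^sub>n\<^sup>* / \<kappa>\<^sub>n\<close>, so that \<open>r\<close> and \<open>rb\<close> are the reflection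
  coefficients.\<close>

locale szego = moment_functional +
  fixes \<Phi> \<Psi> :: "nat \<Rightarrow> 'a::field poly"
  assumes Phi_coeff: "i > n \<Longrightarrow> coeff (\<Phi> n) i = 0"
    and Phi_lead: "coeff (\<Phi> n) n = 1"
    and Psi_coeff: "i > n \<Longrightarrow> coeff (\<Psi> n) i = 0"
    and Psi_0: "coeff (\<Psi> n) 0 = 1"
    and Phi_orth: "k < n \<Longrightarrow> L (- int k) (\<Phi> n) = 0"
    and Psi_orth: "1 \<le> k \<Longrightarrow> k \<le> n \<Longrightarrow> L (- int k) (\<Psi> n) = 0"
    and nonsing: "\<lbrakk>\<And>i. n \<le> i \<Longrightarrow> coeff q i = 0; \<And>k. k < n \<Longrightarrow> L (- int k) q = 0\<rbrakk> \<Longrightarrow> q = 0"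
begin

abbreviation r :: "nat \<Rightarrow> 'a" where "r n \<equiv> coeff (\<Phi> n) 0"
abbreviation rb :: "nat \<Rightarrow> 'a" where "rb n \<equiv> coeff (\<Psi> n) n"

text \<open>Dividing \<open>p\<close> by z reduces this to \<open>nonsing\<close>. It is the
  uniqueness principle behind most recurrences below: subtract the claimed right side, then check
  degree, constant term and n orthogonality relations.\<close>

lemma vanish:
  assumes "\<And>i. n < i \<Longrightarrow> coeff p i = 0" and "coeff p 0 = 0"
    and "\<And>k. 1 \<le> k \<Longrightarrow> k \<le> n \<Longrightarrow> L (- int k) p = 0"
  shows "p = 0"
proof (cases p)
  case (pCons c q)
  then have p: "p = pCons 0 q" using assms(2) by simp
  have "q = 0"
  proof (rule nonsing[of n])
    fix i assume "n \<le> i"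
    then show "coeff q i = 0" using assms(1)[of "Suc i"] p by simp
  next
    fix k assume "k < n"
    then show "L (- int k) q = 0" using assms(3)[of "Suc k"] p by (simp add: L_shift)
  qed
  then show ?thesis using p by simp
qed

lemma Phi_shift_orth: "1 \<le> k \<Longrightarrow> k \<le> n \<Longrightarrow> L (1 - int k) (\<Phi> n) = 0"
  using Phi_orth[of "k - 1" n] by (simp add: of_nat_diff)

text \<open>The Szego recurrence. The leading terms cancel because both polynomials are monic, and
  since \<Psi>_n(0) = 1 the multiple of \<open>\<Psi> n\<close> is the one that matches the constant
  terms.\<close>

lemma Phi_Suc: "\<Phi> (Suc n) = pCons 0 (\<Phi> n) + Polynomial.smult (r (Suc n)) (\<Psi> n)"
proof -
  have "\<Phi> (Suc n) - pCons 0 (\<Phi> n) - Polynomial.smult (r (Suc n)) (\<Psi> n) = 0"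
  proof (rule vanish[of n])
    fix i assume "n < i"
    then show "coeff (\<Phi> (Suc n) - pCons 0 (\<Phi> n) - Polynomial.smult (r (Suc n)) (\<Psi> n)) i = 0"
      by (cases "i = Suc n")
         (auto simp: Phi_coeff Psi_coeff Phi_lead coeff_pCons split: nat.splits)
  next
    fix k assume "1 \<le> k" "k \<le> n"
    then show "L (- int k) (\<Phi> (Suc n) - pCons 0 (\<Phi> n) - Polynomial.smult (r (Suc n)) (\<Psi> n)) = 0"
      by (simp add: L_simps Phi_orth Phi_shift_orth Psi_orth)
  qed (simp add: Psi_0)
  then show ?thesis by (simp add: algebra_simps)
qed

lemma Psi_Suc: "\<Psi> (Suc n) = \<Psi> n + Polynomial.smult (rb (Suc n)) (pCons 0 (\<Phi> n))"
proof -
  have "\<Psi> (Suc n) - \<Psi> n - Polynomial.smult (rb (Suc n)) (pCons 0 (\<Phi> n)) = 0"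
  proof (rule vanish[of n])
    fix i assume "n < i"
    then show "coeff (\<Psi> (Suc n) - \<Psi> n - Polynomial.smult (rb (Suc n)) (pCons 0 (\<Phi> n))) i = 0"
      by (cases "i = Suc n")
         (auto simp: Phi_coeff Psi_coeff Phi_lead coeff_pCons split: nat.splits)
  next
    fix k assume "1 \<le> k" "k \<le> n"
    then show "L (- int k) (\<Psi> (Suc n) - \<Psi> n - Polynomial.smult (rb (Suc n)) (pCons 0 (\<Phi> n))) = 0"
      by (simp add: L_simps Phi_shift_orth Psi_orth)
  qed (simp add: Psi_0)
  then show ?thesis by (simp add: algebra_simps)
qed

lemma norm_Suc: "L (- int (Suc n)) (\<Phi> (Suc n)) = L (- int n) (\<Phi> n) * (1 - r (Suc n) * rb (Suc n))"
proof -
  \<comment> \<open>The last orthogonality relation of \<open>\<Psi> (Suc n)\<close> evaluates the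
    first moment at which \<open>\<Psi> n\<close> need not vanish; the shift turns z \<Phi>_n into
    the norm of \<Phi>_n.\<close>
  have "L (- int (Suc n)) (\<Psi> n + Polynomial.smult (rb (Suc n)) (pCons 0 (\<Phi> n))) = 0"
    using Psi_orth[of "Suc n" "Suc n"] by (subst Psi_Suc[symmetric]) simp
  then have *: "L (- 1 - int n) (\<Psi> n) = - rb (Suc n) * L (- int n) (\<Phi> n)"
    by (simp add: L_simps eq_neg_iff_add_eq_0)
  have "L (- int (Suc n)) (\<Phi> (Suc n))
      = L (- int (Suc n)) (pCons 0 (\<Phi> n) + Polynomial.smult (r (Suc n)) (\<Psi> n))"
    by (subst Phi_Suc) (rule refl)
  with * show ?thesis by (simp add: L_simps algebra_simps)
qed

end

section \<open>Christoffel and Geronimus transformations\<close>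

locale christoffel =
  szego L \<Phi> \<Psi> + S: szego L' \<Phi>' \<Psi>'
  for L L' :: "int \<Rightarrow> 'a::field poly \<Rightarrow> 'a" and \<Phi> \<Psi> \<Phi>' \<Psi>' +
  fixes a :: 'a
  assumes L'_eq: "L' k p = L (k + 1) p - a * L k p" and a_nz: "a \<noteq> 0"
begin

text \<open>\<open>L\<close> applied to (z - a) p is \<open>L'\<close> applied to p, so (z - a)
  \<Psi>'_n has degree at most n + 1 and satisfies the n relations shared by z \<Phi>_n and
  \<Psi>_n. These two span all such polynomials; top and constant coefficient give the
  factors.\<close>

lemma Psi_christoffel:
  "[:-a, 1:] * \<Psi>' n = Polynomial.smult (S.rb n) (pCons 0 (\<Phi> n)) - Polynomial.smult a (\<Psi> n)"
proof -
  have "[:-a, 1:] * \<Psi>' n - Polynomial.smult (S.rb n) (pCons 0 (\<Phi> n)) + Polynomial.smult a (\<Psi> n) = 0"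
  proof (rule vanish[of n])
    fix i assume "n < i"
    then show "coeff ([:-a, 1:] * \<Psi>' n - Polynomial.smult (S.rb n) (pCons 0 (\<Phi> n)) + Polynomial.smult a (\<Psi> n)) i = 0"
      by (cases "i = Suc n")
         (auto simp: S.Psi_coeff Phi_coeff Psi_coeff Phi_lead coeff_pCons split: nat.splits)
  next
    fix k assume k: "1 \<le> k" "k \<le> n"
    have "L (- int k) ([:-a, 1:] * \<Psi>' n) = L' (- int k) (\<Psi>' n)"
      by (simp add: L'_eq L_simps)
    then show "L (- int k) ([:-a, 1:] * \<Psi>' n - Polynomial.smult (S.rb n) (pCons 0 (\<Phi> n)) + Polynomial.smult a (\<Psi> n)) = 0"
      using k by (simp add: L_simps Phi_shift_orth Psi_orth S.Psi_orth)
  qed (simp add: S.Psi_0 Psi_0)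
  then show ?thesis by (simp add: algebra_simps)
qed

text \<open>The multiplier \<open>c\<close> stays implicit: evaluation at \<open>a\<close>, where
  the left side vanishes, determines it later without any integral.\<close>

lemma Phi_christoffel:
  obtains c where "[:-a, 1:] * \<Phi>' n = \<Phi> (Suc n) + Polynomial.smult c (\<Phi> n)"
proof -
  define D where "D = [:-a, 1:] * \<Phi>' n - \<Phi> (Suc n)"
  have "D - Polynomial.smult (coeff D n) (\<Phi> n) = 0"
  proof (rule nonsing[of n])
    fix i assume i: "n \<le> i"
    show "coeff (D - Polynomial.smult (coeff D n) (\<Phi> n)) i = 0"
    proof (cases "i = n")
      case False
      with i have "i > n" by simp
      then have "coeff D i = 0" unfolding D_def
        by (cases "i = Suc n")
           (auto simp: S.Phi_coeff S.Phi_lead Phi_coeff Phi_lead coeff_pCons split: nat.splits)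
      with \<open>i > n\<close> show ?thesis by (simp add: Phi_coeff)
    qed (simp add: Phi_lead)
  next
    fix k assume k: "k < n"
    have "L (- int k) ([:-a, 1:] * \<Phi>' n) = L' (- int k) (\<Phi>' n)"
      by (simp add: L'_eq L_simps)
    then have "L (- int k) D = 0" unfolding D_def
      using k by (simp add: L_minus Phi_orth S.Phi_orth)
    then show "L (- int k) (D - Polynomial.smult (coeff D n) (\<Phi> n)) = 0"
      using k by (simp add: L_simps Phi_orth)
  qed
  then show thesis using that[of "coeff D n"] by (simp add: D_def algebra_simps)
qed

lemma rb_christoffel:
  assumes "poly (\<Phi> n) a \<noteq> 0"
  shows "S.rb n = poly (\<Psi> n) a / poly (\<Phi> n) a"
  using arg_cong[OF Psi_christoffel[of n], of "\<lambda>p. poly p a"] assms a_nz by (simp add: field_simps)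

lemma r_christoffel:
  assumes "poly (\<Phi> n) a \<noteq> 0"
  shows "a * S.r n = poly (\<Phi> (Suc n)) a / poly (\<Phi> n) a * r n - r (Suc n)"
proof -
  obtain c where c: "[:-a, 1:] * \<Phi>' n = \<Phi> (Suc n) + Polynomial.smult c (\<Phi> n)" by (rule Phi_christoffel)
  have "poly (\<Phi> (Suc n)) a + c * poly (\<Phi> n) a = 0"
    using arg_cong[OF c, of "\<lambda>p. poly p a"] by simp
  then have "c = - poly (\<Phi> (Suc n)) a / poly (\<Phi> n) a"
    using assms by (simp add: field_simps eq_neg_iff_add_eq_0)
  moreover have "- a * S.r n = r (Suc n) + c * r n"
    using arg_cong[OF c, of "\<lambda>p. coeff p 0"] by simp
  ultimately show ?thesis by (simp add: algebra_simps)
qed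

text \<open>Read in the other direction, \<open>L\<close> is the functional of the weight divided by \<open>z - a\<close>.\<close>

lemma Phi_geronimus: "\<Phi> (Suc n) = pCons 0 (\<Phi>' n) + Polynomial.smult (r (Suc n)) (\<Psi>' n)"
proof -
  have "\<Phi> (Suc n) - pCons 0 (\<Phi>' n) - Polynomial.smult (r (Suc n)) (\<Psi>' n) = 0"
  proof (rule S.vanish[of n])
    fix i assume "n < i"
    then show "coeff (\<Phi> (Suc n) - pCons 0 (\<Phi>' n) - Polynomial.smult (r (Suc n)) (\<Psi>' n)) i = 0"
      by (cases "i = Suc n")
         (auto simp: Phi_coeff S.Phi_coeff S.Psi_coeff Phi_lead S.Phi_lead coeff_pCons split: nat.splits)
  next
    fix k assume k: "1 \<le> k" "k \<le> n"
    then have "L' (- int k) (\<Phi> (Suc n)) = 0"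
      using Phi_orth[of "k - 1" "Suc n"] Phi_orth[of k "Suc n"] by (simp add: L'_eq of_nat_diff)
    then show "L' (- int k) (\<Phi> (Suc n) - pCons 0 (\<Phi>' n) - Polynomial.smult (r (Suc n)) (\<Psi>' n)) = 0"
      using k by (simp add: S.L_simps S.Phi_shift_orth S.Psi_orth)
  qed (simp add: S.Psi_0)
  then show ?thesis by (simp add: algebra_simps)
qed

text \<open>Here one relation is missing: \<open>L'\<close> at index -1 involves
  \<open>L 0 (\<Psi> (Suc n))\<close>, which orthogonality does not control. This leaves a
  one-parameter freedom, spanned by z \<Psi>'_n.\<close>

lemma Psi_geronimus:
  obtains c where "\<Psi> (Suc n) = \<Psi>' (Suc n) + Polynomial.smult c (pCons 0 (\<Psi>' n))"
proof -
  obtain b q where q: "\<Psi> (Suc n) - \<Psi>' (Suc n) = pCons b q" by (cases "\<Psi> (Suc n) - \<Psi>' (Suc n)")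
  have "b = 0" using arg_cong[OF q, of "\<lambda>p. coeff p 0"] by (simp add: Psi_0 S.Psi_0)
  have "q - Polynomial.smult (coeff q 0) (\<Psi>' n) = 0"
  proof (rule S.vanish[of n])
    fix i assume "n < i"
    then show "coeff (q - Polynomial.smult (coeff q 0) (\<Psi>' n)) i = 0"
      using arg_cong[OF q, of "\<lambda>p. coeff p (Suc i)"] by (simp add: Psi_coeff S.Psi_coeff)
  next
    fix k assume k: "1 \<le> k" "k \<le> n"
    have "L' (- int k) q = L' (- int (Suc k)) (pCons 0 q)" by (simp add: S.L_shift)
    also have "\<dots> = L' (- int (Suc k)) (\<Psi> (Suc n)) - L' (- int (Suc k)) (\<Psi>' (Suc n))"
      using q \<open>b = 0\<close> by (simp flip: S.L_minus)
    also have "\<dots> = 0"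
      using k Psi_orth[of k "Suc n"] Psi_orth[of "Suc k" "Suc n"] S.Psi_orth[of "Suc k" "Suc n"]
      by (simp add: L'_eq)
    finally show "L' (- int k) (q - Polynomial.smult (coeff q 0) (\<Psi>' n)) = 0"
      using k by (simp add: S.L_simps S.Psi_orth)
  qed (simp add: S.Psi_0)
  then show thesis using that[of "coeff q 0"] q \<open>b = 0\<close> by (simp add: algebra_simps)
qed

text \<open>\<alpha> and \<beta> are the two quotients in \<open>R_plus\<close>. The four relations
  are what the matrix identity amounts to once powers of z are compared.\<close>

lemma compat_christoffel:
  assumes nz: "\<And>n. poly (\<Phi> n) a \<noteq> 0"
  defines "\<alpha> \<equiv> \<lambda>n. poly (\<Phi> (Suc n)) a / poly (\<Phi> n) a" and "\<beta> \<equiv> \<lambda>n. poly (\<Psi> n) a / poly (\<Phi> n) a"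
  shows "S.rb (Suc n) = \<beta> (Suc n)"
    and "r (Suc (Suc n)) - \<alpha> (Suc n) * r (Suc n) = - a * S.r (Suc n)"
    and "\<beta> (Suc n) * \<alpha> n = \<beta> n + a * rb (Suc n)"
    and "r (Suc (Suc n)) * rb (Suc n) - \<alpha> (Suc n) = S.r (Suc n) * \<beta> n - \<alpha> n"
proof -
  show 1: "S.rb (Suc n) = \<beta> (Suc n)" unfolding \<beta>_def by (rule rb_christoffel[OF nz])
  show 2: "r (Suc (Suc n)) - \<alpha> (Suc n) * r (Suc n) = - a * S.r (Suc n)"
    using r_christoffel[OF nz, of "Suc n"] by (simp add: \<alpha>_def)
  have \<alpha>: "\<alpha> m = a + r (Suc m) * \<beta> m" for m
    using nz[of m] by (simp add: \<alpha>_def \<beta>_def arg_cong[OF Phi_Suc, of "\<lambda>p. poly p a"] add_divide_distrib)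
  \<comment> \<open>The values of \<Phi>_{n+1} at \<open>a\<close> cancel, so only \<Psi>_{n+1} has
    to be expanded.\<close>
  have "\<beta> (Suc n) * \<alpha> n = poly (\<Psi> (Suc n)) a / poly (\<Phi> n) a"
    using nz[of "Suc n"] by (simp add: \<alpha>_def \<beta>_def)
  also have "\<dots> = \<beta> n + a * rb (Suc n)"
    using nz[of n] by (subst Psi_Suc) (simp add: \<beta>_def add_divide_distrib)
  finally show 3: "\<beta> (Suc n) * \<alpha> n = \<beta> n + a * rb (Suc n)" .
  show "r (Suc (Suc n)) * rb (Suc n) - \<alpha> (Suc n) = S.r (Suc n) * \<beta> n - \<alpha> n"
    by (rule christoffel_scalar[OF a_nz 2 3 \<alpha> \<alpha>])
qed

text \<open>\<open>L\<close> is applied to the Szego recurrences of the multiplied weight. The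
  integrals \<open>L 1 (\<Phi>' n)\<close> that arise are known because \<Phi>_{n+1} is orthogonal
  to 1 and \<open>Phi_geronimus\<close> expands it.\<close>

lemma L_Phi_geronimus:
  "L 1 (\<Phi>' n) = - r (Suc n) * L 0 (\<Psi>' n)"
  "L 0 (\<Phi>' (Suc n)) = (S.r (Suc n) - r (Suc n)) * L 0 (\<Psi>' n)"
  "a * L 0 (\<Phi>' (Suc n)) = - r (Suc (Suc n)) * L 0 (\<Psi>' (Suc n))"
  "L 0 (\<Psi>' (Suc n)) = (1 - S.rb (Suc n) * r (Suc n)) * L 0 (\<Psi>' n)"
proof -
  show 1: "L 1 (\<Phi>' n) = - r (Suc n) * L 0 (\<Psi>' n)" for n
  proof -
    have "L 0 (pCons 0 (\<Phi>' n) + Polynomial.smult (r (Suc n)) (\<Psi>' n)) = 0"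
      using Phi_orth[of 0 "Suc n"] by (subst Phi_geronimus[symmetric]) simp
    then show ?thesis by (simp add: L_simps eq_neg_iff_add_eq_0)
  qed
  show "L 0 (\<Phi>' (Suc n)) = (S.r (Suc n) - r (Suc n)) * L 0 (\<Psi>' n)"
    by (subst S.Phi_Suc) (simp add: L_simps 1 algebra_simps)
  show "L 0 (\<Psi>' (Suc n)) = (1 - S.rb (Suc n) * r (Suc n)) * L 0 (\<Psi>' n)"
    by (subst S.Psi_Suc) (simp add: L_simps 1 algebra_simps)
  have "L' 0 (\<Phi>' (Suc n)) = 0" using S.Phi_orth[of 0 "Suc n"] by simp
  then show "a * L 0 (\<Phi>' (Suc n)) = - r (Suc (Suc n)) * L 0 (\<Psi>' (Suc n))"
    using 1[of "Suc n"] by (simp add: L'_eq)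
qed

text \<open>Each relation \<open>L' (- int k) (\<Psi>' n) = 0\<close> says that lowering the power
  of \<zeta> by one costs a factor \<open>a\<close>. The right side is the form in which the value
  of \<xi>*_n at \<open>a\<close> arises.\<close>

lemma L_0_Psi: "L 0 (\<Psi>' n) = a ^ n * L (- int n) (\<Psi>' n)"
proof -
  have "k \<le> n \<Longrightarrow> L 0 (\<Psi>' n) = a ^ k * L (- int k) (\<Psi>' n)" for k
  proof (induction k)
    case (Suc k)
    then have "L (- int k) (\<Psi>' n) = a * L (- int (Suc k)) (\<Psi>' n)"
      using S.Psi_orth[of "Suc k" n] by (simp add: L'_eq)
    with Suc show ?case by simp
  qed simp
  then show ?thesis by simp
qed

lemma rb_geronimus:
  assumes nz: "L 0 (\<Psi>' n) \<noteq> 0"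
  shows "a * rb (Suc n) = a * S.rb (Suc n) - (1 - S.rb (Suc n) * r (Suc n)) * S.rb n"
proof -
  obtain c where c: "\<Psi> (Suc n) = \<Psi>' (Suc n) + Polynomial.smult c (pCons 0 (\<Psi>' n))" by (rule Psi_geronimus)
  \<comment> \<open>Orthogonality under \<open>L\<close> itself, not only under \<open>L'\<close>,
    fixes the multiplier \<open>c\<close>.\<close>
  have "L (- 1) (\<Psi>' (Suc n)) + c * L 0 (\<Psi>' n) = 0"
    using Psi_orth[of 1 "Suc n"] c by (simp add: L_add L_smult L_shift del: smult_pCons)
  moreover have "a * L (- 1) (\<Psi>' (Suc n)) = L 0 (\<Psi>' (Suc n))"
    using S.Psi_orth[of 1 "Suc n"] by (simp add: L'_eq)
  ultimately have "a * (c * L 0 (\<Psi>' n)) = - ((1 - S.rb (Suc n) * r (Suc n)) * L 0 (\<Psi>' n))"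
    unfolding L_Phi_geronimus(4)
    by (metis add_eq_0_iff mult_minus_right)
  then have ac: "a * c = - (1 - S.rb (Suc n) * r (Suc n))"
    using nz by (metis mult.assoc mult_minus_left mult_right_cancel)
  have "rb (Suc n) = S.rb (Suc n) + c * S.rb n"
    using arg_cong[OF c, of "\<lambda>p. coeff p (Suc n)"] by simp
  then have rb: "a * rb (Suc n) = a * S.rb (Suc n) + a * c * S.rb n" by (simp add: distrib_left)
  show ?thesis unfolding rb ac by (simp only: mult_minus_left diff_conv_add_uminus)
qed

text \<open>\<open>p n\<close> and \<open>q n\<close> are the first-row entries of
  \<open>R_minus\<close> at index n + 1 without its prefactor. The denominators come from
  \<kappa>_n^2 / \<kappa>_{n+1}^2 = 1 - r rb for the multiplied weight.\<close>

lemma compat_geronimus: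
  assumes nz: "\<And>n. L 0 (\<Psi>' n) \<noteq> 0" and nd: "\<And>n. S.r (Suc n) * S.rb (Suc n) \<noteq> 1"
  defines "p \<equiv> \<lambda>n. L 0 (\<Psi>' (Suc n)) / (L 0 (\<Psi>' n) * (1 - S.r (Suc n) * S.rb (Suc n)))"
    and "q \<equiv> \<lambda>n. - L 0 (\<Phi>' (Suc n)) / (L 0 (\<Psi>' n) * (1 - S.r (Suc n) * S.rb (Suc n)))"
  shows "a * q n = r (Suc (Suc n)) * p n"
    and "p n + S.rb (Suc n) * q n = 1"
    and "p n * S.r (Suc n) + q n = r (Suc n)"
    and "a * S.rb (Suc (Suc n)) = p n * (a * rb (Suc (Suc n)) + S.rb (Suc n))"
    and "p (Suc n) * (S.rb (Suc (Suc n)) * S.r (Suc (Suc n)) - 1) = rb (Suc (Suc n)) * a * q n - p n"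
proof -
  have nd': "1 - S.r (Suc n) * S.rb (Suc n) \<noteq> 0" for n using nd[of n] by simp
  have p: "p n * (1 - S.r (Suc n) * S.rb (Suc n)) = 1 - S.rb (Suc n) * r (Suc n)" for n
    using nz[of n] nd'[of n] by (simp add: p_def L_Phi_geronimus(4))
  have q: "q n * (1 - S.r (Suc n) * S.rb (Suc n)) = r (Suc n) - S.r (Suc n)" for n
    using nz[of n] nd'[of n] by (simp add: q_def L_Phi_geronimus(2) field_simps)
  have "a * q n = - (a * L 0 (\<Phi>' (Suc n))) / (L 0 (\<Psi>' n) * (1 - S.r (Suc n) * S.rb (Suc n)))"
    by (simp add: q_def)
  then show 1: "a * q n = r (Suc (Suc n)) * p n"
    unfolding L_Phi_geronimus(3) by (simp add: p_def)
  note scalar = geronimus_scalar[OF a_nz nd' p q p 1 rb_geronimus[OF nz]]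
  show "p n + S.rb (Suc n) * q n = 1" by (rule scalar(1))
  show "p n * S.r (Suc n) + q n = r (Suc n)" by (rule scalar(2))
  show "a * S.rb (Suc (Suc n)) = p n * (a * rb (Suc (Suc n)) + S.rb (Suc n))" by (rule scalar(3))
  show "p (Suc n) * (S.rb (Suc (Suc n)) * S.r (Suc (Suc n)) - 1) = rb (Suc (Suc n)) * a * q n - p n"
    by (rule scalar(4))
qed

end

section \<open>Boundary values of Cauchy integrals\<close>

lemma ode_singular_ratio_bounds:
  fixes u b :: "real \<Rightarrow> complex" and \<rho> :: complex
  assumes der: "\<And>x. 0 < x \<Longrightarrow> x \<le> \<eta> \<Longrightarrow> (u has_vector_derivative (\<rho> / x + b x) * u x) (at x)"
    and b: "\<And>x. 0 < x \<Longrightarrow> x \<le> \<eta> \<Longrightarrow> norm (b x) \<le> K"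
    and xy: "0 < x" "x \<le> y" "y \<le> \<eta>"
  shows "norm (u x) \<le> norm (u y) * (x / y) powr Re \<rho> * exp (K * (y - x))"
    and "norm (u y) * (x / y) powr Re \<rho> \<le> norm (u x) * exp (K * (y - x))"
proof -
  \<comment> \<open>This is |u|^2 exp(2 c t) t^(-2 Re \<rho>). Its derivative has the sign of Re b +
    c, so it is monotone in opposite directions for c = K and c = -K. The square keeps it
    differentiable where \<open>u\<close> vanishes.\<close>
  define M where "M c t = (u t \<bullet> u t) * exp (2 * (c * t - Re \<rho> * ln t))" for c t
  have M_der: "(M c has_real_derivative
      2 * (Re (b t) + c) * (u t \<bullet> u t) * exp (2 * (c * t - Re \<rho> * ln t))) (at t)"
    if "0 < t" "t \<le> \<eta>" for c t
  proof -
    have "((\<lambda>t. u t \<bullet> u t) has_real_derivative 2 * (u t \<bullet> ((\<rho> / t + b t) * u t))) (at t)"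
      using der[OF that]
      by (auto simp: has_vector_derivative_def has_field_derivative_def inner_commute algebra_simps
          intro!: derivative_eq_intros)
    moreover have "u t \<bullet> ((\<rho> / t + b t) * u t) = (Re \<rho> / t + Re (b t)) * (u t \<bullet> u t)"
      by (simp add: inner_complex_def algebra_simps add_divide_distrib diff_divide_distrib)
    ultimately have "((\<lambda>t. u t \<bullet> u t) has_real_derivative
        2 * ((Re \<rho> / t + Re (b t)) * (u t \<bullet> u t))) (at t)" by simp
    then show ?thesis
      unfolding M_def using that
      by (auto intro!: derivative_eq_intros simp: field_simps)
  qed
  have exp_M: "M c t = (norm (u t) * exp (c * t) * t powr (- Re \<rho>))\<^sup>2" if "0 < t" for c t
  proof -
    have "exp (2 * (c * t - Re \<rho> * ln t)) = (exp (c * t) * t powr (- Re \<rho>))\<^sup>2"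
      using that by (simp add: powr_def power2_eq_square flip: exp_add)
    then show ?thesis by (simp add: M_def power2_norm_eq_inner power_mult_distrib)
  qed
  have "M K x \<le> M K y"
    using xy(2)
  proof (rule DERIV_nonneg_imp_nondecreasing)
    fix t assume t: "x \<le> t" "t \<le> y"
    have "- Re (b t) \<le> K" using b[of t] t xy abs_Re_le_cmod[of "b t"] by linarith
    then show "\<exists>d. DERIV (M K) t :> d \<and> 0 \<le> d"
      using M_der[of t K] t xy
      by (intro exI[of _ "2 * (Re (b t) + K) * (u t \<bullet> u t) * exp (2 * (K * t - Re \<rho> * ln t))"])
         (auto intro!: mult_nonneg_nonneg)
  qed
  then have 1: "norm (u x) * exp (K * x) * x powr (- Re \<rho>) \<le> norm (u y) * exp (K * y) * y powr (- Re \<rho>)"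
    using xy by (simp add: exp_M)
  have "M (- K) y \<le> M (- K) x"
    using xy(2)
  proof (rule DERIV_nonpos_imp_nonincreasing)
    fix t assume t: "x \<le> t" "t \<le> y"
    have "Re (b t) \<le> K" using b[of t] t xy abs_Re_le_cmod[of "b t"] by linarith
    then show "\<exists>d. DERIV (M (- K)) t :> d \<and> d \<le> 0"
      using M_der[of t "- K"] t xy
      by (intro exI[of _ "2 * (Re (b t) - K) * (u t \<bullet> u t) * exp (2 * (- K * t - Re \<rho> * ln t))"])
         (auto simp: mult_le_0_iff)
  qed
  then have 2: "norm (u y) * exp (- K * y) * y powr (- Re \<rho>) \<le> norm (u x) * exp (- K * x) * x powr (- Re \<rho>)"
    using xy by (simp add: exp_M)
  have p: "x powr (- Re \<rho>) * x powr Re \<rho> = 1" "(x / y) powr Re \<rho> = x powr Re \<rho> * y powr (- Re \<rho>)"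
    using xy by (simp_all add: powr_divide powr_minus field_simps)
  have e: "exp (K * y) * exp (- K * x) = exp (K * (y - x))" "exp (K * x) * exp (- K * x) = 1"
    "exp (K * y) * exp (- K * y) = 1"
    by (simp_all add: algebra_simps flip: exp_add)
  have "norm (u x) = norm (u x) * exp (K * x) * x powr (- Re \<rho>) * (x powr Re \<rho> * exp (- K * x))"
  proof -
    have "norm (u x) * exp (K * x) * x powr (- Re \<rho>) * (x powr Re \<rho> * exp (- K * x))
        = norm (u x) * (x powr (- Re \<rho>) * x powr Re \<rho>) * (exp (K * x) * exp (- K * x))"
      by (simp only: ac_simps)
    then show ?thesis by (simp only: p(1) e(2) mult_1_right)
  qed
  also have "\<dots> \<le> norm (u y) * exp (K * y) * y powr (- Re \<rho>) * (x powr Re \<rho> * exp (- K * x))"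
    using 1 by (rule mult_right_mono) simp
  also have "\<dots> = norm (u y) * (x / y) powr Re \<rho> * exp (K * (y - x))"
    unfolding p(2) e(1)[symmetric] by (simp add: algebra_simps)
  finally show "norm (u x) \<le> norm (u y) * (x / y) powr Re \<rho> * exp (K * (y - x))" .
  have "norm (u y) * (x / y) powr Re \<rho> = norm (u y) * exp (- K * y) * y powr (- Re \<rho>) * (x powr Re \<rho> * exp (K * y))"
    unfolding p(2) using e(3) by (simp add: algebra_simps)
  also have "\<dots> \<le> norm (u x) * exp (- K * x) * x powr (- Re \<rho>) * (x powr Re \<rho> * exp (K * y))"
    using 2 by (rule mult_right_mono) simp
  also have "\<dots> = norm (u x) * exp (K * (y - x))"
    unfolding e(1)[symmetric] using p(1) by (simp add: algebra_simps)
  finally show "norm (u y) * (x / y) powr Re \<rho> \<le> norm (u x) * exp (K * (y - x))" .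
qed

lemma not_integrable_inverse_at_0:
  fixes c \<eta> :: real
  assumes "c > 0" "\<eta> > 0" and f: "f integrable_on {0..\<eta>}"
    and "\<And>x. 0 < x \<Longrightarrow> x \<le> \<eta> \<Longrightarrow> c / x \<le> f x" and nonneg: "\<And>x. 0 \<le> x \<Longrightarrow> x \<le> \<eta> \<Longrightarrow> 0 \<le> f x"
  shows False
proof -
  define I where "I = integral {0..\<eta>} f"
  \<comment> \<open>Chosen so that c / x has integral I + 1 over {\<epsilon>..\<eta>}, more than the
    whole integral of \<open>f\<close>.\<close>
  define \<epsilon> where "\<epsilon> = \<eta> * exp (- (I + 1) / c)"
  have "0 \<le> I" unfolding I_def using nonneg by (intro integral_nonneg[OF f]) auto
  then have "- (I + 1) / c \<le> 0" using assms by (intro divide_nonpos_pos) auto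
  then have \<epsilon>: "0 < \<epsilon>" "\<epsilon> \<le> \<eta>" using assms by (simp_all add: \<epsilon>_def mult_left_le)
  have "((\<lambda>x. c / x) has_integral (c * ln \<eta> - c * ln \<epsilon>)) {\<epsilon>..\<eta>}"
    using \<epsilon> by (intro fundamental_theorem_of_calculus)
      (auto intro!: derivative_eq_intros simp: field_simps simp flip: has_real_derivative_iff_has_vector_derivative)
  moreover have fe: "f integrable_on {\<epsilon>..\<eta>}" using f \<epsilon> by (auto intro: integrable_subinterval_real)
  ultimately have "c * ln \<eta> - c * ln \<epsilon> \<le> integral {\<epsilon>..\<eta>} f"
    using assms \<epsilon> by (intro has_integral_le[OF _ integrable_integral]) auto
  also have "\<dots> \<le> I" unfolding I_def
    using f fe nonneg \<epsilon> by (intro integral_subset_le) auto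
  finally have "c * ln \<eta> - c * ln \<epsilon> \<le> I" .
  moreover have "ln \<epsilon> = ln \<eta> - (I + 1) / c" using assms by (simp add: \<epsilon>_def ln_mult diff_divide_distrib add_divide_distrib)
  then have "c * ln \<eta> - c * ln \<epsilon> = c * ((I + 1) / c)" by (simp only: right_diff_distrib)
  moreover have "c * ((I + 1) / c) = I + 1" using assms by simp
  ultimately show False by simp
qed

text \<open>If Re \<rho> \<le> 0, a solution that is not identically 0 is bounded below near 0,
  against the integrability of |u| / x. For Re \<rho> > 0 the ratio bounds give |u| \<le> C
  x^\<sigma> and, through the equation, |u'| \<le> C x^(\<sigma> - 1).\<close>

lemma ode_singular_holder:
  fixes u b :: "real \<Rightarrow> complex" and \<rho> :: complex
  assumes \<eta>: "0 < \<eta>" "\<eta> \<le> 1"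
    and der: "\<And>x. 0 < x \<Longrightarrow> x \<le> \<eta> \<Longrightarrow> (u has_vector_derivative (\<rho> / x + b x) * u x) (at x)"
    and b: "\<And>x. 0 < x \<Longrightarrow> x \<le> \<eta> \<Longrightarrow> norm (b x) \<le> K"
    and f: "f integrable_on {0..\<eta>}" "\<And>x. 0 \<le> x \<Longrightarrow> x \<le> \<eta> \<Longrightarrow> 0 \<le> f x"
    and u_f: "\<And>x. 0 < x \<Longrightarrow> x \<le> \<eta> \<Longrightarrow> norm (u x) / x \<le> f x"
  obtains \<sigma> L where "0 < \<sigma>" "\<sigma> \<le> 1" "0 \<le> L"
    "\<And>x. 0 < x \<Longrightarrow> x < \<eta> \<Longrightarrow> norm (u x) \<le> L * x powr \<sigma>"
    "\<And>x y. 0 < x \<Longrightarrow> x \<le> y \<Longrightarrow> y < \<eta> \<Longrightarrow> norm (u x - u y) \<le> L * (y - x) powr \<sigma>"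
proof (cases "\<forall>x. 0 < x \<and> x < \<eta> \<longrightarrow> u x = 0")
  \<comment> \<open>A weight may be zero on a whole arc; then nothing follows about Re
    \<rho>.\<close>
  case True
  then show thesis using that[of 1 0] by simp
next
  case False
  then obtain y where y: "0 < y" "y < \<eta>" "u y \<noteq> 0" by blast
  have K: "0 \<le> K" using b[of y] y norm_ge_zero[of "b y"] by linarith
  note ratio = ode_singular_ratio_bounds[of \<eta> u \<rho> b K, OF der b, simplified]
  have "Re \<rho> > 0"
  proof (rule ccontr)
    assume \<rho>: "\<not> Re \<rho> > 0"
    have "f integrable_on {0..y}"
      using f(1) y by (auto intro: integrable_subinterval_real)
    moreover have "norm (u y) * exp (- K) / x \<le> f x" if x: "0 < x" "x \<le> y" for x
    proof -
      have "1 \<le> (x / y) powr Re \<rho>"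
        using \<rho> x y powr_mono'[of "Re \<rho>" 0 "x / y"] by simp
      then have "norm (u y) * 1 \<le> norm (u y) * (x / y) powr Re \<rho>" by (intro mult_left_mono) auto
      also have "\<dots> \<le> norm (u x) * exp (K * (y - x))" using ratio(2) x y by simp
      also have "\<dots> \<le> norm (u x) * exp K"
        using K x y \<eta> by (intro mult_left_mono) (auto simp: mult_left_le)
      finally have "norm (u y) * exp (- K) \<le> norm (u x)"
        by (simp add: exp_minus field_simps)
      then have "norm (u y) * exp (- K) / x \<le> norm (u x) / x" using x by (simp add: divide_right_mono)
      also have "\<dots> \<le> f x" using x y by (intro u_f) auto
      finally show ?thesis .
    qed
    ultimately show False
      using y f(2) by (intro not_integrable_inverse_at_0[of "norm (u y) * exp (- K)" y f]) auto
  qed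
  \<comment> \<open>Capped at 1 so that x^(\<sigma> - 1) is nonincreasing, as the mean value
    estimate below requires.\<close>
  define \<sigma> where "\<sigma> = min (Re \<rho>) 1"
  have \<sigma>: "0 < \<sigma>" "\<sigma> \<le> 1" "\<sigma> \<le> Re \<rho>" using \<open>Re \<rho> > 0\<close> by (auto simp: \<sigma>_def)
  define L0 where "L0 = norm (u \<eta>) * \<eta> powr (- Re \<rho>) * exp K"
  define L1 where "L1 = (norm \<rho> + K) * L0"
  have L: "0 \<le> L0" "0 \<le> L1" using K by (auto simp: L0_def L1_def)
  have u_le: "norm (u x) \<le> L0 * x powr \<sigma>" if x: "0 < x" "x \<le> \<eta>" for x
  proof -
    have "norm (u x) \<le> norm (u \<eta>) * (x / \<eta>) powr Re \<rho> * exp (K * (\<eta> - x))"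
      using ratio(1) x by simp
    also have "\<dots> \<le> norm (u \<eta>) * (x / \<eta>) powr Re \<rho> * exp K"
      using K x \<eta> by (intro mult_left_mono) (auto simp: mult_left_le)
    also have "\<dots> = L0 * x powr Re \<rho>"
      using x by (simp add: L0_def powr_divide powr_minus field_simps)
    also have "\<dots> \<le> L0 * x powr \<sigma>"
      using x \<eta> \<sigma> L by (intro mult_left_mono powr_mono') auto
    finally show ?thesis .
  qed
  have u'_le: "norm ((\<rho> / x + b x) * u x) \<le> L1 * x powr (\<sigma> - 1)" if x: "0 < x" "x \<le> \<eta>" for x
  proof -
    have "norm (\<rho> / x + b x) \<le> norm \<rho> / x + K"
      using b[OF x] x by (intro order.trans[OF norm_triangle_ineq]) (simp add: norm_divide)
    also have "\<dots> \<le> (norm \<rho> + K) / x"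
      using x \<eta> K by (simp add: add_divide_distrib pos_le_divide_eq mult_left_le)
    finally have "norm ((\<rho> / x + b x) * u x) \<le> (norm \<rho> + K) / x * (L0 * x powr \<sigma>)"
      using u_le[OF x] K x unfolding norm_mult by (intro mult_mono) auto
    also have "\<dots> = L1 * x powr (\<sigma> - 1)"
      using x by (simp add: L1_def powr_diff)
    finally show ?thesis .
  qed
  show thesis
  proof (rule that[OF \<sigma>(1,2), of "3 * L0 + L1"])
    fix x assume x: "0 < x" "x < \<eta>"
    have "norm (u x) \<le> L0 * x powr \<sigma>" using x by (intro u_le) auto
    also have "\<dots> \<le> (3 * L0 + L1) * x powr \<sigma>" using L by (intro mult_right_mono) auto
    finally show "norm (u x) \<le> (3 * L0 + L1) * x powr \<sigma>" .
  next
    fix x y assume xy: "0 < x" "x \<le> y" "y < \<eta>"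
    \<comment> \<open>If the gap is at least \<open>x\<close>, then also y \<le> 2 (y - x), and the
      size bound suffices, contributing L0 + 2 L0 as \<sigma> \<le> 1. Otherwise t > x > y - x
      bounds the derivative in the mean value inequality.\<close>
    consider "x = y" | "y - x \<ge> x" "x < y" | "y - x < x" "x < y" using xy by linarith
    then show "norm (u x - u y) \<le> (3 * L0 + L1) * (y - x) powr \<sigma>"
    proof cases
      case 1 then show ?thesis by simp
    next
      case 2
      have "norm (u x - u y) \<le> L0 * x powr \<sigma> + L0 * y powr \<sigma>"
        using u_le[of x] u_le[of y] xy norm_triangle_ineq4[of "u x" "u y"] by linarith
      also have "\<dots> \<le> L0 * (y - x) powr \<sigma> + L0 * (2 * (y - x)) powr \<sigma>"
        using L xy 2 \<sigma> by (intro add_mono mult_left_mono powr_mono2) auto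
      also have "\<dots> = L0 * (y - x) powr \<sigma> + L0 * (2 powr \<sigma> * (y - x) powr \<sigma>)"
        using 2 by (subst powr_mult) auto
      also have "\<dots> \<le> L0 * (y - x) powr \<sigma> + L0 * (2 powr 1 * (y - x) powr \<sigma>)"
        using L \<sigma> by (intro add_mono mult_left_mono mult_right_mono powr_mono) auto
      also have "\<dots> \<le> (3 * L0 + L1) * (y - x) powr \<sigma>" using L by (simp add: algebra_simps)
      finally show ?thesis .
    next
      case 3
      have "\<exists>t\<in>{x<..<y}. norm (u y - u x) \<le> norm ((y - x) *\<^sub>R ((\<rho> / t + b t) * u t))"
      proof (rule mvt_general[of x y u "\<lambda>t h. h *\<^sub>R ((\<rho> / t + b t) * u t)", OF 3(2)])
        show "continuous_on {x..y} u"
        proof (intro continuous_at_imp_continuous_on ballI)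
          fix t assume "t \<in> {x..y}"
          then have "(u has_vector_derivative (\<rho> / t + b t) * u t) (at t)" using der xy by auto
          then show "isCont u t" by (rule has_vector_derivative_continuous)
        qed
      qed (use der xy in \<open>auto simp: has_vector_derivative_def\<close>)
      then obtain t where t: "x < t" "t < y" "norm (u y - u x) \<le> norm ((y - x) *\<^sub>R ((\<rho> / t + b t) * u t))"
        by auto
      note t(3)
      also have "norm ((y - x) *\<^sub>R ((\<rho> / t + b t) * u t)) = (y - x) * norm ((\<rho> / t + b t) * u t)"
        using 3 by simp
      also have "\<dots> \<le> (y - x) * (L1 * t powr (\<sigma> - 1))"
        using 3 t xy by (intro mult_left_mono u'_le) auto
      also have "\<dots> \<le> (y - x) * (L1 * (y - x) powr (\<sigma> - 1))"
        using 3 t xy L \<sigma> by (intro mult_left_mono powr_mono2') auto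
      also have "\<dots> = L1 * (y - x) powr \<sigma>" using 3 by (simp add: powr_diff)
      also have "\<dots> \<le> (3 * L0 + L1) * (y - x) powr \<sigma>" using L by (intro mult_right_mono) auto
      finally show ?thesis by (simp add: norm_minus_commute)
    qed
  qed (use L in auto)
qed

section \<open>Chords, rotations and the Cauchy kernel on the circle\<close>

lemma sin_pi_ge:
  fixes d :: real
  assumes "\<bar>d\<bar> \<le> 1 / 2"
  shows "\<bar>d\<bar> \<le> \<bar>sin (pi * d)\<bar>"
proof -
  define y where "y = pi * \<bar>d\<bar>"
  have "pi \<le> 3.2" using pi_approx by simp
  have y: "0 \<le> y" "y \<le> 1.6"
    unfolding y_def using assms mult_mono[OF \<open>pi \<le> 3.2\<close> assms] by auto
  \<comment> \<open>Since 1.6^2 < 3, the cubic error y^3 / 6 is at most y / 2, and y / 2 \<ge> |d|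
    already.\<close>
  then have "y * y \<le> 1.6 * 1.6" by (intro mult_mono) auto
  have "\<bar>sin y - y\<bar> \<le> inverse (fact 3) * \<bar>y\<bar> ^ 3"
    using Maclaurin_sin_bound[of y 3] by (simp add: sin_coeff_def numeral_eq_Suc)
  then have "\<bar>sin y - y\<bar> \<le> y * (y * y) / 6"
    using y by (simp add: fact_numeral power3_eq_cube field_simps)
  then have "sin y \<ge> y - y * (y * y) / 6" by linarith
  moreover have "y * (y * y) \<le> y * 3" using \<open>y * y \<le> _\<close> y by (intro mult_left_mono) auto
  ultimately have "y / 2 \<le> sin y" by simp
  moreover have "\<bar>d\<bar> * 2 \<le> y" unfolding y_def using pi_ge_two by (subst mult.commute) (intro mult_right_mono, auto)
  moreover have "\<bar>sin (pi * d)\<bar> = \<bar>sin y\<bar>" by (simp add: y_def abs_if)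
  ultimately show ?thesis by linarith
qed

lemma norm_cis_diff:
  fixes x s :: real
  shows "norm (cis (2 * pi * x) - cis (2 * pi * s)) = 2 * \<bar>sin (pi * (x - s))\<bar>"
proof -
  have "cis (2 * pi * x) - cis (2 * pi * s)
      = cis (pi * (x + s)) * (cis (pi * (x - s)) - cis (- (pi * (x - s))))"
    by (simp add: right_diff_distrib cis_mult algebra_simps)
  also have "cis (pi * (x - s)) - cis (- (pi * (x - s))) = of_real (2 * sin (pi * (x - s))) * \<i>"
    by (simp add: complex_eq_iff)
  finally show ?thesis by (simp add: norm_mult)
qed

lemma integral_powr_dist:
  fixes s \<eta> \<sigma> :: real
  assumes "0 < \<sigma>" "\<bar>s\<bar> \<le> \<eta>"
  shows "((\<lambda>x. \<bar>x - s\<bar> powr (\<sigma> - 1)) has_integral ((\<eta> - s) powr \<sigma> + (\<eta> + s) powr \<sigma>) / \<sigma>) {-\<eta>..\<eta>}"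
proof -
  \<comment> \<open>A signed antiderivative, continuous across \<open>s\<close>, so that one
    exceptional point in the fundamental theorem replaces an improper integral.\<close>
  define G where "G x = sgn (x - s) * \<bar>x - s\<bar> powr \<sigma> / \<sigma>" for x
  have G_pos: "G x = (x - s) powr \<sigma> / \<sigma>" if "x \<ge> s" for x
    using that by (cases "x = s") (auto simp: G_def)
  have G_neg: "G x = - ((s - x) powr \<sigma> / \<sigma>)" if "x \<le> s" for x
    using that by (cases "x = s") (auto simp: G_def)
  have "((\<lambda>x. \<bar>x - s\<bar> powr (\<sigma> - 1)) has_integral (G \<eta> - G (- \<eta>))) {-\<eta>..\<eta>}"
  proof (rule fundamental_theorem_of_calculus_interior_strong[of "{s}"])
    fix x assume "x \<in> {-\<eta><..<\<eta>} - {s}"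
    then consider "x > s" | "x < s" by fastforce
    then have "(G has_real_derivative \<bar>x - s\<bar> powr (\<sigma> - 1)) (at x)"
    proof cases
      case 1
      have "((\<lambda>x. (x - s) powr \<sigma> / \<sigma>) has_real_derivative \<bar>x - s\<bar> powr (\<sigma> - 1)) (at x)"
        using 1 assms by (auto intro!: derivative_eq_intros simp: powr_diff field_simps)
      then show ?thesis
        by (rule has_field_derivative_transform_within_open[of _ _ _ "{s<..}"]) (use 1 in \<open>auto simp: G_pos\<close>)
    next
      case 2
      have "((\<lambda>x. - ((s - x) powr \<sigma> / \<sigma>)) has_real_derivative \<bar>x - s\<bar> powr (\<sigma> - 1)) (at x)"
        using 2 assms by (auto intro!: derivative_eq_intros simp: powr_diff field_simps)
      then show ?thesis
        by (rule has_field_derivative_transform_within_open[of _ _ _ "{..<s}"]) (use 2 in \<open>auto simp: G_neg\<close>)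
    qed
    then show "(G has_vector_derivative \<bar>x - s\<bar> powr (\<sigma> - 1)) (at x)"
      by (simp add: has_real_derivative_iff_has_vector_derivative)
  next
    have "continuous_on ({-\<eta>..s} \<union> {s..\<eta>}) G"
    proof (rule continuous_on_closed_Un)
      show "continuous_on {-\<eta>..s} G"
        by (subst continuous_on_cong[OF refl G_neg], simp)
           (use assms in \<open>intro continuous_on_powr' continuous_intros; auto\<close>)
      show "continuous_on {s..\<eta>} G"
        by (subst continuous_on_cong[OF refl G_pos], simp)
           (use assms in \<open>intro continuous_on_powr' continuous_intros; auto\<close>)
    qed auto
    moreover have "{-\<eta>..s} \<union> {s..\<eta>} = {-\<eta>..\<eta>}" using assms by auto
    ultimately show "continuous_on {-\<eta>..\<eta>} G" by simp
  qed (use assms in auto)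
  moreover have "G \<eta> - G (-\<eta>) = ((\<eta> - s) powr \<sigma> + (\<eta> + s) powr \<sigma>) / \<sigma>"
    using assms G_pos[of \<eta>] G_neg[of "- \<eta>"] by (auto simp: add_divide_distrib add.commute abs_le_iff)
  ultimately show ?thesis by simp
qed

text \<open>Puts the singular point in the middle of the parameter interval, so that both adjacent
  arcs lie around x = 0. The shifted path starts at -a and hence passes \<open>a\<close> at
  parameter 1/2.\<close>

lemma has_integral_circle_rotate:
  fixes f :: "complex \<Rightarrow> complex"
  assumes a: "norm a = 1" and f: "((\<lambda>t. f (circlepath 0 1 t)) has_integral I) {0..1}"
  shows "((\<lambda>x. f (a * cis (2 * pi * x))) has_integral I) {-1/2..1/2}"
proof -
  define c where "c = circlepath 0 1"
  define F where "F \<zeta> = f \<zeta> / (2 * of_real pi * \<i> * \<zeta>)" for \<zeta>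
  have c: "c t = cis (2 * pi * t)" "vector_derivative c (at t) = 2 * pi * \<i> * cis (2 * pi * t)" for t
    by (simp_all add: c_def vector_derivative_circlepath) (simp_all add: circlepath cis_conv_exp mult_ac)
  have "(F has_contour_integral I) c"
    using f unfolding has_contour_integral F_def c c_def[symmetric] by (simp add: field_simps)
  moreover have "- a \<in> path_image c" using a by (simp add: c_def)
  then obtain b where b: "b \<in> {0..1}" "c b = - a" by (auto simp: path_image_def)
  ultimately have *: "(F has_contour_integral I) (shiftpath b c)"
    by (intro has_contour_integral_shiftpath) (auto simp: c_def)
  have sh: "shiftpath b c = (\<lambda>t. - a * cis (2 * pi * t))"
  proof
    fix t
    have "c (b + t - 1) = c (b + t)" using circlepath_add1[of 0 1 "b + t - 1"] by (simp add: c_def)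
    then have "shiftpath b c t = c (b + t)" by (simp add: shiftpath_def)
    also have "\<dots> = c b * cis (2 * pi * t)" by (simp add: c cis_mult algebra_simps)
    finally show "shiftpath b c t = - a * cis (2 * pi * t)" by (simp add: b)
  qed
  have "((\<lambda>t. - a * cis (2 * pi * t)) has_vector_derivative - a * (2 * pi * \<i> * cis (2 * pi * t))) (at t)" for t
    using has_vector_derivative_mult_right[OF has_vector_derivative_circlepath[of 0 1 t UNIV], of "- a"]
    by (simp add: circlepath cis_conv_exp mult_ac)
  then have "vector_derivative (\<lambda>t. - a * cis (2 * pi * t)) (at t) = - a * (2 * pi * \<i> * cis (2 * pi * t))" for t
    by (rule vector_derivative_at)
  moreover have "F (- a * cis (2 * pi * t)) * (- a * (2 * pi * \<i> * cis (2 * pi * t))) = f (- a * cis (2 * pi * t))" for t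
    using a by (auto simp: F_def)
  ultimately have "((\<lambda>t. f (- a * cis (2 * pi * t))) has_integral I) {0..1}"
    using * unfolding has_contour_integral sh by (simp only:)
  moreover have "- a * cis (2 * pi * t) = a * cis (2 * pi * (t - 1 / 2))" for t
    by (simp add: algebra_simps cis_divide[symmetric])
  ultimately have "(((\<lambda>t. f (a * cis (2 * pi * (t - 1 / 2)))) has_integral I) {-1/2 + 1/2..1/2 + 1/2})"
    by simp
  then show ?thesis
    by (subst (asm) has_integral_shift_Icc_real[symmetric]) (simp add: o_def)
qed

text \<open>The integral of the absolute value blows up as z nears the circle, but the integral
  itself is explicit: 0 inside, -1/z outside. The lower bound on |z| keeps z \<noteq> 0 in the
  partial fractions.\<close>

lemma norm_integral_cauchy_kernel_le:
  assumes a: "norm a = 1" and z: "norm z \<noteq> 1" "1 / 2 \<le> norm z"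
  shows "norm (integral {-1/2..1/2} (\<lambda>x. 1 / (a * cis (2 * pi * x) - z))) \<le> 2"
proof -
  define J where "J = (if norm z < 1 then 0 else - 1 / z)"
  have "((\<lambda>\<zeta>. 1 / (\<zeta> - z) / (2 * of_real pi * \<i> * \<zeta>)) has_contour_integral J) (circlepath 0 1)"
  proof (cases "norm z < 1")
    case True
    have "((\<lambda>\<zeta>. 1 / (\<zeta> - z) - 1 / (\<zeta> - 0)) has_contour_integral
        2 * of_real pi * \<i> * 1 - 2 * of_real pi * \<i> * 1) (circlepath 0 1)"
      using True by (intro has_contour_integral_diff Cauchy_integral_circlepath) (auto intro!: continuous_intros)
    then have "((\<lambda>\<zeta>. (1 / (\<zeta> - z) - 1 / \<zeta>) * (1 / (2 * of_real pi * \<i> * z))) has_contour_integral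
        0 * (1 / (2 * of_real pi * \<i> * z))) (circlepath 0 1)"
      by (intro has_contour_integral_rmul) simp
    then have "((\<lambda>\<zeta>. 1 / (\<zeta> - z) / (2 * of_real pi * \<i> * \<zeta>)) has_contour_integral
        0 * (1 / (2 * of_real pi * \<i> * z))) (circlepath 0 1)"
    proof (rule has_contour_integral_eq)
      fix \<zeta> :: complex assume "\<zeta> \<in> path_image (circlepath 0 1)"
      then have "\<zeta> \<noteq> 0" "\<zeta> \<noteq> z" "z \<noteq> 0" using z by auto
      then show "(1 / (\<zeta> - z) - 1 / \<zeta>) * (1 / (2 * of_real pi * \<i> * z)) = 1 / (\<zeta> - z) / (2 * of_real pi * \<i> * \<zeta>)"
        by (simp add: field_simps)
    qed
    with True show ?thesis by (simp add: J_def)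
  next
    case False
    have "((\<lambda>\<zeta>. 1 / (\<zeta> - z) / (\<zeta> - 0)) has_contour_integral 2 * of_real pi * \<i> * (1 / (0 - z))) (circlepath 0 1)"
      using False z by (intro Cauchy_integral_circlepath) (auto intro!: continuous_intros holomorphic_intros)
    then have "((\<lambda>\<zeta>. 1 / (\<zeta> - z) / (\<zeta> - 0) * (1 / (2 * of_real pi * \<i>))) has_contour_integral
        2 * of_real pi * \<i> * (1 / (0 - z)) * (1 / (2 * of_real pi * \<i>))) (circlepath 0 1)"
      by (rule has_contour_integral_rmul)
    then show ?thesis using False by (simp add: J_def field_simps)
  qed
  then have "((\<lambda>t. 1 / (circlepath 0 1 t - z)) has_integral J) {0..1}"
    unfolding has_contour_integral vector_derivative_circlepath
    by (simp add: circlepath divide_divide_eq_left')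
  from has_integral_circle_rotate[OF a, of "\<lambda>\<zeta>. 1 / (\<zeta> - z)", OF this]
  have "integral {-1/2..1/2} (\<lambda>x. 1 / (a * cis (2 * pi * x) - z)) = J"
    by (rule integral_unique)
  moreover have "1 / norm z \<le> 1 / (1 / 2)" using z by (intro divide_left_mono) auto
  then have "norm J \<le> 2" by (simp add: J_def norm_divide)
  ultimately show ?thesis by simp
qed

section \<open>Continuity of the Cauchy integral at a boundary point\<close>

lemma absolutely_integrable_mult_continuous:
  fixes f g :: "real \<Rightarrow> complex"
  assumes "f absolutely_integrable_on {p..q}" "continuous_on {p..q} g"
  shows "(\<lambda>x. f x * g x) absolutely_integrable_on {p..q}"
proof -
  have "(\<lambda>x. g x * f x) absolutely_integrable_on {p..q}"
    using assms
    by (intro absolutely_integrable_bounded_measurable_product[OF bilinear_times])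
       (auto intro!: continuous_imp_measurable_on_sets_lebesgue compact_imp_bounded compact_continuous_image)
  then show ?thesis by (simp add: mult.commute)
qed

text \<open>The point \<open>e s\<close> is a nearest point of the circle to \<open>z\<close>, so that the singularity of the
  kernel is no worse than \<open>1 / \<bar>x - s\<bar>\<close>, which subtracting \<open>u s\<close> makes integrable.\<close>

lemma norm_integral_cauchy_near_le:
  fixes u e :: "real \<Rightarrow> complex"
  assumes \<sigma>: "0 < \<sigma>" and L: "0 \<le> L" and s: "\<bar>s\<bar> \<le> \<eta>"
    and hol: "\<And>x. \<bar>x\<bar> \<le> \<eta> \<Longrightarrow> norm (u x - u s) \<le> L * \<bar>x - s\<bar> powr \<sigma>"
    and dist: "\<And>x. \<bar>x\<bar> \<le> \<eta> \<Longrightarrow> \<bar>x - s\<bar> \<le> norm (e x - z)"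
    and int: "(\<lambda>x. (u x - u s) * inverse (e x - z)) integrable_on {-\<eta>..\<eta>}"
  shows "norm (integral {-\<eta>..\<eta>} (\<lambda>x. (u x - u s) * inverse (e x - z))) \<le> 2 * L / \<sigma> * (2 * \<eta>) powr \<sigma>"
proof -
  note pd = has_integral_mult_right[OF integral_powr_dist[OF \<sigma> s], of L]
  have "norm (integral {-\<eta>..\<eta>} (\<lambda>x. (u x - u s) * inverse (e x - z)))
      \<le> integral {-\<eta>..\<eta>} (\<lambda>x. L * \<bar>x - s\<bar> powr (\<sigma> - 1))"
  proof (rule integral_norm_bound_integral[OF int])
    show "(\<lambda>x. L * \<bar>x - s\<bar> powr (\<sigma> - 1)) integrable_on {-\<eta>..\<eta>}" using pd by blast
    fix x assume "x \<in> {-\<eta>..\<eta>}"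
    then have x: "\<bar>x\<bar> \<le> \<eta>" by auto
    show "norm ((u x - u s) * inverse (e x - z)) \<le> L * \<bar>x - s\<bar> powr (\<sigma> - 1)"
    proof (cases "x = s")
      case False
      then have "norm ((u x - u s) * inverse (e x - z)) \<le> L * \<bar>x - s\<bar> powr \<sigma> * inverse \<bar>x - s\<bar>"
        unfolding norm_mult norm_inverse using hol[OF x] dist[OF x] L
        by (intro mult_mono le_imp_inverse_le) auto
      also have "\<dots> = L * \<bar>x - s\<bar> powr (\<sigma> - 1)" using False by (simp add: powr_diff field_simps)
      finally show ?thesis .
    qed simp
  qed
  also have "\<dots> = L * (((\<eta> - s) powr \<sigma> + (\<eta> + s) powr \<sigma>) / \<sigma>)"
    using pd by (rule integral_unique)
  also have "\<dots> \<le> L * (((2 * \<eta>) powr \<sigma> + (2 * \<eta>) powr \<sigma>) / \<sigma>)"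
    using s L \<sigma> by (intro mult_left_mono divide_right_mono add_mono powr_mono2) auto
  finally show ?thesis by (simp add: algebra_simps)
qed

text \<open>At distance \<eta> and beyond, the kernels at z and \<open>a\<close> differ by O(|z -
  a|). Within \<eta>, \<open>u s\<close> is subtracted for the point \<open>e s\<close> nearest to
  z; what is left, \<open>u s\<close> times the kernel integral, is small because u(s) tends to u(0)
  = 0 while that integral is at most 2 + 1/\<eta>. Radial and angular distance of z are never
  related, so tangential approach is covered.\<close>

lemma cauchy_integral_limit:
  fixes u :: "real \<Rightarrow> complex" and a :: complex
  defines "e \<equiv> \<lambda>x. a * cis (2 * pi * x)"
  assumes a: "norm a = 1"
    and u: "u absolutely_integrable_on {-1/2..1/2}"
    and u_quot: "(\<lambda>x. u x * inverse (e x - a)) integrable_on {-1/2..1/2}"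
    and \<sigma>: "0 < \<sigma>" and \<eta>0: "0 < \<eta>0" "\<eta>0 \<le> 1 / 4" and L: "0 \<le> L" and u0: "u 0 = 0"
    and hol: "\<And>x s. \<bar>x\<bar> \<le> \<eta>0 \<Longrightarrow> \<bar>s\<bar> \<le> \<eta>0 \<Longrightarrow> norm (u x - u s) \<le> L * \<bar>x - s\<bar> powr \<sigma>"
  shows "((\<lambda>z. integral {-1/2..1/2} (\<lambda>x. u x * inverse (e x - z))) \<longlongrightarrow>
           integral {-1/2..1/2} (\<lambda>x. u x * inverse (e x - a))) (at a within - sphere 0 1)"
proof -
  have e_norm [simp]: "norm (e x) = 1" for x using a by (simp add: e_def norm_mult)
  have e_cont: "continuous_on S e" for S unfolding e_def cis_conv_exp by (intro continuous_intros)
  have e_dist: "2 * \<bar>x - s\<bar> \<le> norm (e x - e s)" if "\<bar>x - s\<bar> \<le> 1 / 2" for x s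
  proof -
    have "norm (e x - e s) = norm (cis (2 * pi * x) - cis (2 * pi * s))"
      using a by (simp add: e_def norm_mult flip: right_diff_distrib)
    then show ?thesis using sin_pi_ge[OF that] by (simp add: norm_cis_diff)
  qed
  have e0: "e 0 = a" by (simp add: e_def)
  define A where "A = integral {-1/2..1/2} (\<lambda>x. norm (u x))"
  have u_norm: "(\<lambda>x. norm (u x)) integrable_on {-1/2..1/2}" using u by (simp add: absolutely_integrable_on_def)
  have A: "0 \<le> A" unfolding A_def by (rule integral_nonneg[OF u_norm]) simp
  \<comment> \<open>With \<delta> the distance from z to \<open>a\<close>, the terms bound the two
    near parts, the \<open>u s\<close> term and the two far parts. \<eta> will be fixed before
    \<delta> tends to 0.\<close>
  define E where "E \<eta> \<delta> = 4 * L / \<sigma> * (2 * \<eta>) powr \<sigma> + L * \<delta> powr \<sigma> * (2 + 1 / \<eta>) + \<delta> * (A / \<eta>\<^sup>2)" for \<eta> \<delta>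
  have main: "norm (integral {-1/2..1/2} (\<lambda>x. u x * inverse (e x - z)) -
      integral {-1/2..1/2} (\<lambda>x. u x * inverse (e x - a))) \<le> E \<eta> (norm (z - a))"
    if \<eta>: "0 < \<eta>" "\<eta> \<le> \<eta>0" and z: "norm z \<noteq> 1" "norm (z - a) < \<eta>" for z \<eta>
  proof -
    \<comment> \<open>The angle of z relative to \<open>a\<close>, so that \<open>e s\<close> is the
      radial projection of z to the circle.\<close>
    define s where "s = Arg (z / a) / (2 * pi)"
    have "norm z \<ge> 1 - \<eta>" using norm_triangle_ineq3[of z a] a z by (simp add: abs_le_iff)
    then have nz: "1 / 2 \<le> norm z" using \<eta> \<eta>0 by linarith
    then have "z \<noteq> 0" "a \<noteq> 0" using a by auto
    have "norm z * cis (2 * pi * s) = z / a"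
      using rcis_cmod_Arg[of "z / a"] a by (simp add: s_def rcis_def norm_divide)
    then have z_eq: "z = norm z * e s" using \<open>a \<noteq> 0\<close> by (simp add: e_def field_simps)
    have es: "norm (e s - z) \<le> norm (e x - z)" for x
    proof -
      have "e s - z = of_real (1 - norm z) * e s" by (subst z_eq) (simp add: algebra_simps)
      then have "norm (e s - z) = \<bar>1 - norm z\<bar>" by (simp add: norm_mult del: of_real_diff)
      then show ?thesis using norm_triangle_ineq3[of "e x" z] by simp
    qed
    \<comment> \<open>|e x - e s| \<le> 2 |e x - z| because \<open>e s\<close> is nearest to z; the
      factor 2 in \<open>e_dist\<close> absorbs the loss.\<close>
    have e_dist2: "\<bar>x - s\<bar> \<le> norm (e x - z)" if "\<bar>x - s\<bar> \<le> 1 / 2" for x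
      using e_dist[OF that] es[of x] norm_triangle_ineq[of "e x - z" "z - e s"]
      by (simp add: norm_minus_commute)
    have "\<bar>s\<bar> \<le> 1 / 2"
      using Arg_bounded[of "z / a"] by (simp add: s_def abs_le_iff field_simps)
    then have s: "\<bar>s\<bar> \<le> norm (z - a)"
      using e_dist2[of 0] by (simp add: e0 norm_minus_commute)
    then have s\<eta>: "\<bar>s\<bar> \<le> \<eta>" using z by simp
    have ez: "e x - z \<noteq> 0" for x using z by auto
    have inv_int: "(\<lambda>x. inverse (e x - z)) integrable_on {p..q}" for p q
      using ez by (intro integrable_continuous_interval continuous_intros e_cont) auto
    have ui: "(\<lambda>x. u x * inverse (e x - z)) integrable_on {-1/2..1/2}"
      using u ez by (intro set_lebesgue_integral_eq_integral(1) absolutely_integrable_mult_continuous)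
        (auto intro!: continuous_intros e_cont)
    define D where "D x = u x * inverse (e x - z) - u x * inverse (e x - a)" for x
    have D_int: "D integrable_on {-1/2..1/2}" unfolding D_def by (intro integrable_diff ui u_quot)
    have sub: "f integrable_on {p..q}" if "f integrable_on {-1/2..1/2}" "-1/2 \<le> p" "q \<le> 1/2"
      for f :: "real \<Rightarrow> complex" and p q
      using that by (auto intro: integrable_subinterval_real)
    have split3: "integral {-1/2..1/2} f =
        integral {-1/2..-\<eta>} f + integral {-\<eta>..\<eta>} f + integral {\<eta>..1/2} f"
      if "f integrable_on {-1/2..1/2}" for f :: "real \<Rightarrow> complex"
      using that \<eta> \<eta>0 Henstock_Kurzweil_Integration.integral_combine[where a = "-1/2" and c = "-\<eta>" and b = "1/2" and f = f] Henstock_Kurzweil_Integration.integral_combine[where a = "-\<eta>" and c = "\<eta>" and b = "1/2" and f = f]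
        sub[OF that, where p = "-\<eta>" and q = "1/2"] by (simp add: add.assoc)
    have far: "\<eta> \<le> norm (e x - z)" "2 * \<eta> \<le> norm (e x - a)" if "\<eta> \<le> \<bar>x\<bar>" "\<bar>x\<bar> \<le> 1 / 2" for x
    proof -
      show *: "2 * \<eta> \<le> norm (e x - a)" using e_dist[of x 0] that by (simp add: e0)
      show "\<eta> \<le> norm (e x - z)"
        using * z norm_triangle_ineq[of "e x - z" "z - a"] by simp
    qed
    have far_bound: "norm (integral {p..q} D) \<le> norm (z - a) * (A / (2 * \<eta>\<^sup>2))"
      if pq: "-1/2 \<le> p" "q \<le> 1/2" and far_pq: "\<And>x. x \<in> {p..q} \<Longrightarrow> \<eta> \<le> \<bar>x\<bar>" for p q
    proof -
      have un: "(\<lambda>x. norm (u x)) integrable_on {p..q}"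
        using u_norm pq by (auto intro: integrable_subinterval_real)
      have "norm (integral {p..q} D) \<le> integral {p..q} (\<lambda>x. norm (z - a) / (2 * \<eta>\<^sup>2) * norm (u x))"
      proof (rule integral_norm_bound_integral[OF sub[OF D_int pq]])
        show "(\<lambda>x. norm (z - a) / (2 * \<eta>\<^sup>2) * norm (u x)) integrable_on {p..q}"
          using un by (intro integrable_on_mult_right)
        fix x assume x: "x \<in> {p..q}"
        have f: "\<eta> \<le> norm (e x - z)" "2 * \<eta> \<le> norm (e x - a)"
          using far[of x] far_pq[OF x] x pq by auto
        then have "e x - a \<noteq> 0" using \<eta> by auto
        then have "D x = (z - a) * u x / ((e x - z) * (e x - a))"
          using ez[of x] by (simp add: D_def field_simps)
        then have "norm (D x) = norm (z - a) * norm (u x) / (norm (e x - z) * norm (e x - a))"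
          by (simp add: norm_mult norm_divide)
        also have "\<dots> \<le> norm (z - a) * norm (u x) / (\<eta> * (2 * \<eta>))"
          using f \<eta> by (intro divide_left_mono mult_mono mult_pos_pos) auto
        finally show "norm (D x) \<le> norm (z - a) / (2 * \<eta>\<^sup>2) * norm (u x)"
          by (simp add: power2_eq_square mult_ac)
      qed
      also have "\<dots> = norm (z - a) / (2 * \<eta>\<^sup>2) * integral {p..q} (\<lambda>x. norm (u x))" by simp
      also have "\<dots> \<le> norm (z - a) / (2 * \<eta>\<^sup>2) * A"
        unfolding A_def using un u_norm pq by (intro mult_left_mono integral_subset_le) auto
      finally show ?thesis by simp
    qed
    have "norm (integral {-\<eta>..\<eta>} (\<lambda>x. inverse (e x - z))) \<le> 2 + 1 / \<eta>"
    proof -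
      have side: "norm (integral {p..q} (\<lambda>x. inverse (e x - z))) \<le> (1 / 2) * (1 / \<eta>)"
        if pq: "-1/2 \<le> p" "p \<le> q" "q \<le> 1/2" "q - p \<le> 1 / 2" and "\<And>x. x \<in> {p..q} \<Longrightarrow> \<eta> \<le> \<bar>x\<bar>" for p q
      proof -
        have "norm (integral {p..q} (\<lambda>x. inverse (e x - z))) \<le> inverse \<eta> * (q - p)"
        proof (rule integral_bound)
          show "continuous_on {p..q} (\<lambda>x. inverse (e x - z))"
            using ez by (intro continuous_intros e_cont) auto
          fix x assume "x \<in> {p..q}"
          then have "\<eta> \<le> norm (e x - z)" using that by (intro far) auto
          then show "norm (inverse (e x - z)) \<le> inverse \<eta>"
            unfolding norm_inverse using \<eta> by (intro le_imp_inverse_le) auto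
        qed (use pq in auto)
        also have "\<dots> \<le> inverse \<eta> * (1 / 2)" using pq \<eta> by (intro mult_left_mono) auto
        finally show ?thesis by (simp add: field_simps)
      qed
      have s1: "norm (integral {-1/2..-\<eta>} (\<lambda>x. inverse (e x - z))) \<le> (1 / 2) * (1 / \<eta>)"
      proof (rule side[where p = "-1/2" and q = "-\<eta>"])
        show "\<eta> \<le> \<bar>x\<bar>" if "x \<in> {-1/2..-\<eta>}" for x using that \<eta> by auto
      qed (use \<eta> \<eta>0 in linarith)+
      have s2: "norm (integral {\<eta>..1/2} (\<lambda>x. inverse (e x - z))) \<le> (1 / 2) * (1 / \<eta>)"
      proof (rule side[where p = "\<eta>" and q = "1/2"])
        show "\<eta> \<le> \<bar>x\<bar>" if "x \<in> {\<eta>..1/2}" for x using that \<eta> by auto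
      qed (use \<eta> \<eta>0 in linarith)+
      have s3: "norm (integral {-1/2..1/2} (\<lambda>x. inverse (e x - z))) \<le> 2"
        unfolding inverse_eq_divide e_def by (rule norm_integral_cauchy_kernel_le[OF a z(1) nz])
      \<comment> \<open>The near integral is estimated as the explicit full one minus two far
        pieces, where the kernel is at most 1/\<eta>; a direct bound would not be uniform in
        z.\<close>
      have "integral {-\<eta>..\<eta>} (\<lambda>x. inverse (e x - z)) = integral {-1/2..1/2} (\<lambda>x. inverse (e x - z))
          - integral {-1/2..-\<eta>} (\<lambda>x. inverse (e x - z)) - integral {\<eta>..1/2} (\<lambda>x. inverse (e x - z))"
        using split3[OF inv_int] by simp
      also have "norm \<dots> \<le> 2 + (1 / 2) * (1 / \<eta>) + (1 / 2) * (1 / \<eta>)"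
        using norm_triangle_ineq4[of "integral {-1/2..1/2} (\<lambda>x. inverse (e x - z)) - integral {-1/2..-\<eta>} (\<lambda>x. inverse (e x - z))" "integral {\<eta>..1/2} (\<lambda>x. inverse (e x - z))"]
          norm_triangle_ineq4[of "integral {-1/2..1/2} (\<lambda>x. inverse (e x - z))" "integral {-1/2..-\<eta>} (\<lambda>x. inverse (e x - z))"]
          s1 s2 s3 by linarith
      finally show ?thesis by simp
    qed
    then have near2: "norm (u s * integral {-\<eta>..\<eta>} (\<lambda>x. inverse (e x - z))) \<le> L * norm (z - a) powr \<sigma> * (2 + 1 / \<eta>)"
    proof -
      assume *: "norm (integral {-\<eta>..\<eta>} (\<lambda>x. inverse (e x - z))) \<le> 2 + 1 / \<eta>"
      have "norm (u s) \<le> L * \<bar>s\<bar> powr \<sigma>" using hol[of s 0] s\<eta> \<eta> \<eta>0 u0 by simp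
      also have "\<dots> \<le> L * norm (z - a) powr \<sigma>" using s L \<sigma> by (intro mult_left_mono powr_mono2) auto
      finally show ?thesis unfolding norm_mult using * L by (intro mult_mono) auto
    qed
    have near_z: "norm (integral {-\<eta>..\<eta>} (\<lambda>x. (u x - u s) * inverse (e x - z))) \<le> 2 * L / \<sigma> * (2 * \<eta>) powr \<sigma>"
    proof (rule norm_integral_cauchy_near_le[OF \<sigma> L s\<eta>])
      show "(\<lambda>x. (u x - u s) * inverse (e x - z)) integrable_on {-\<eta>..\<eta>}"
        unfolding left_diff_distrib using ui \<eta> \<eta>0
        by (intro integrable_diff sub[OF ui] integrable_on_mult_right inv_int) auto
      fix x assume "\<bar>x\<bar> \<le> \<eta>"
      then have "\<bar>x - s\<bar> \<le> 1 / 2" using s\<eta> \<eta> \<eta>0 by linarith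
      then show "\<bar>x - s\<bar> \<le> norm (e x - z)" by (rule e_dist2)
    qed (use hol s\<eta> \<eta> in auto)
    have near_a: "norm (integral {-\<eta>..\<eta>} (\<lambda>x. (u x - u 0) * inverse (e x - a))) \<le> 2 * L / \<sigma> * (2 * \<eta>) powr \<sigma>"
    proof (rule norm_integral_cauchy_near_le[OF \<sigma> L])
      show "(\<lambda>x. (u x - u 0) * inverse (e x - a)) integrable_on {-\<eta>..\<eta>}"
        using \<eta> \<eta>0 u0 by (simp add: sub[OF u_quot])
      fix x assume x: "\<bar>x\<bar> \<le> \<eta>"
      then show "\<bar>x - 0\<bar> \<le> norm (e x - a)" using e_dist[of x 0] \<eta> \<eta>0 by (simp add: e0)
      show "norm (u x - u 0) \<le> L * \<bar>x - 0\<bar> powr \<sigma>" using hol[of x 0] x \<eta> by simp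
    qed (use \<eta> in auto)
    have ui': "(\<lambda>x. u x * inverse (e x - z)) integrable_on {-\<eta>..\<eta>}" "(\<lambda>x. u x * inverse (e x - a)) integrable_on {-\<eta>..\<eta>}"
      using \<eta> \<eta>0 by (auto intro!: sub[OF ui] sub[OF u_quot])
    have "integral {-\<eta>..\<eta>} D = integral {-\<eta>..\<eta>} (\<lambda>x. (u x - u s) * inverse (e x - z))
        + u s * integral {-\<eta>..\<eta>} (\<lambda>x. inverse (e x - z))
        - integral {-\<eta>..\<eta>} (\<lambda>x. (u x - u 0) * inverse (e x - a))"
      unfolding left_diff_distrib D_def using ui' inv_int integrable_on_mult_right[OF inv_int]
      by (simp add: integral_diff u0)
    also have "norm \<dots> \<le> 2 * L / \<sigma> * (2 * \<eta>) powr \<sigma> + L * norm (z - a) powr \<sigma> * (2 + 1 / \<eta>)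
        + 2 * L / \<sigma> * (2 * \<eta>) powr \<sigma>"
      using near_z near2 near_a
      by (intro order.trans[OF norm_triangle_ineq4 add_mono[OF order.trans[OF norm_triangle_ineq add_mono]]])
    finally have near: "norm (integral {-\<eta>..\<eta>} D) \<le> 4 * L / \<sigma> * (2 * \<eta>) powr \<sigma> + L * norm (z - a) powr \<sigma> * (2 + 1 / \<eta>)"
      by simp
    have f1: "norm (integral {-1/2..-\<eta>} D) \<le> norm (z - a) * (A / (2 * \<eta>\<^sup>2))"
      using \<eta> \<eta>0 by (intro far_bound) auto
    have f2: "norm (integral {\<eta>..1/2} D) \<le> norm (z - a) * (A / (2 * \<eta>\<^sup>2))"
      using \<eta> \<eta>0 by (intro far_bound) auto
    have "norm (integral {-1/2..1/2} D) \<le> norm (z - a) * (A / (2 * \<eta>\<^sup>2)) +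
        (4 * L / \<sigma> * (2 * \<eta>) powr \<sigma> + L * norm (z - a) powr \<sigma> * (2 + 1 / \<eta>)) + norm (z - a) * (A / (2 * \<eta>\<^sup>2))"
      unfolding split3[OF D_int] by (intro order.trans[OF norm_triangle_ineq] add_mono f1 f2 near)
    also have "\<dots> = E \<eta> (norm (z - a))" by (simp add: E_def field_simps)
    finally show ?thesis unfolding D_def Henstock_Kurzweil_Integration.integral_diff[OF ui u_quot] .
  qed
  show ?thesis
  proof (rule tendstoI)
    fix \<epsilon> :: real assume \<epsilon>: "0 < \<epsilon>"
    \<comment> \<open>Only the near term does not shrink with z - a, so \<eta> is chosen to make it
      less than \<epsilon> / 2.\<close>
    have "((\<lambda>\<eta>. 4 * L / \<sigma> * (2 * \<eta>) powr \<sigma>) \<longlongrightarrow> 4 * L / \<sigma> * (2 * 0) powr \<sigma>) (at_right 0)"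
      using \<sigma> by (intro tendsto_intros tendsto_powr'[where b = \<sigma>]) (auto simp: eventually_at_filter)
    then have "\<forall>\<^sub>F \<eta> in at_right 0. 4 * L / \<sigma> * (2 * \<eta>) powr \<sigma> < \<epsilon> / 2"
      using \<epsilon> by (intro order_tendstoD) (auto simp: \<epsilon>)
    moreover have "\<forall>\<^sub>F \<eta> in at_right 0. \<eta> \<in> {0<..<\<eta>0}"
      using \<eta>0 by (intro eventually_at_right_real)
    ultimately have "\<forall>\<^sub>F \<eta> in at_right 0. 4 * L / \<sigma> * (2 * \<eta>) powr \<sigma> < \<epsilon> / 2 \<and> \<eta> \<in> {0<..<\<eta>0}"
      by (rule eventually_conj)
    then obtain \<eta> where \<eta>: "4 * L / \<sigma> * (2 * \<eta>) powr \<sigma> < \<epsilon> / 2" "0 < \<eta>" "\<eta> < \<eta>0"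
      using eventually_happens'[of "at_right (0::real)"] by (auto simp: trivial_limit_at_right_real)
    have "((\<lambda>z. norm (z - a)) \<longlongrightarrow> 0) (at a within - sphere 0 1)"
      by (auto intro!: tendsto_eq_intros)
    then have "((\<lambda>z. E \<eta> (norm (z - a))) \<longlongrightarrow> 4 * L / \<sigma> * (2 * \<eta>) powr \<sigma> + L * 0 powr \<sigma> * (2 + 1 / \<eta>) + 0 * (A / \<eta>\<^sup>2)) (at a within - sphere 0 1)"
      unfolding E_def using \<sigma> by (intro tendsto_intros tendsto_powr'[where b = \<sigma>]) auto
    then have "\<forall>\<^sub>F z in at a within - sphere 0 1. E \<eta> (norm (z - a)) < \<epsilon>"
    proof (rule order_tendstoD(2))
      show "4 * L / \<sigma> * (2 * \<eta>) powr \<sigma> + L * 0 powr \<sigma> * (2 + 1 / \<eta>) + 0 * (A / \<eta>\<^sup>2) < \<epsilon>"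
        using \<eta>(1) \<epsilon> by simp
    qed
    moreover have "\<forall>\<^sub>F z in at a within - sphere 0 1. norm (z - a) < \<eta>"
      using \<eta> by (intro order_tendstoD(2)[of _ 0]) (auto intro!: tendsto_eq_intros)
    moreover have "\<forall>\<^sub>F z in at a within - sphere 0 1. norm z \<noteq> 1"
      by (auto simp: eventually_at_filter)
    ultimately show "\<forall>\<^sub>F z in at a within - sphere 0 1. dist (integral {-1/2..1/2} (\<lambda>x. u x * inverse (e x - z)))
        (integral {-1/2..1/2} (\<lambda>x. u x * inverse (e x - a))) < \<epsilon>"
      by eventually_elim (use main[of \<eta>] \<eta> in \<open>force simp: dist_norm\<close>)
  qed
qed

text \<open>By half angles the first quotient is \<pi> cot(\<pi> x) + \<pi> i, and the cotangent
  term has principal part 1/x. A simple pole at a point of the circle thus becomes 1/x plus a term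
  bounded near 0.\<close>

lemma cis_diff_quotient_tendsto:
  "((\<lambda>x. 2 * pi * \<i> * cis (2 * pi * x) / (cis (2 * pi * x) - 1) - 1 / of_real x) \<longlongrightarrow> pi * \<i>) (at (0::real))"
proof -
  have "((\<lambda>x::real. pi * cos (pi * x) / sin (pi * x) - 1 / x) \<longlongrightarrow> 0) (at 0)"
    by real_asymp
  then have "((\<lambda>x. complex_of_real (pi * cos (pi * x) / sin (pi * x) - 1 / x) + pi * \<i>) \<longlongrightarrow> of_real 0 + pi * \<i>) (at 0)"
    by (intro tendsto_intros)
  moreover have "\<forall>\<^sub>F x::real in at 0. complex_of_real (pi * cos (pi * x) / sin (pi * x) - 1 / x) + pi * \<i>
      = 2 * pi * \<i> * cis (2 * pi * x) / (cis (2 * pi * x) - 1) - 1 / of_real x"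
  proof (unfold eventually_at, intro exI[of _ "1/2"] conjI ballI impI)
    fix x :: real assume "x \<noteq> 0 \<and> dist x 0 < 1 / 2"
    then have x: "x \<noteq> 0" "\<bar>x\<bar> \<le> 1 / 2" by auto
    define y where "y = pi * x"
    have s: "sin y \<noteq> 0" using sin_pi_ge[OF x(2)] x(1) by (auto simp: y_def)
    have c: "cis (2 * pi * x) = cis y * cis y" "cis y * cis (- y) = 1"
      by (simp_all add: y_def cis_mult mult.assoc)
    have d: "cis y - cis (- y) = 2 * \<i> * sin y" by (simp add: complex_eq_iff)
    have "cis (2 * pi * x) - 1 = cis y * (2 * \<i> * sin y)"
      using c(2) unfolding c(1) d[symmetric] by (simp add: algebra_simps)
    then have "2 * pi * \<i> * cis (2 * pi * x) / (cis (2 * pi * x) - 1) = pi * cis y / sin y"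
      using s unfolding c(1) by (simp add: frac_eq_eq mult_ac)
    also have "\<dots> = pi * cos y / sin y + pi * \<i>"
      using s by (simp add: cis_conv_exp exp_Euler cos_of_real sin_of_real field_simps)
    finally show "complex_of_real (pi * cos (pi * x) / sin (pi * x) - 1 / x) + pi * \<i>
      = 2 * pi * \<i> * cis (2 * pi * x) / (cis (2 * pi * x) - 1) - 1 / of_real x"
      by (simp add: y_def)
  qed simp
  ultimately show ?thesis by (simp add: Lim_transform_eventually)
qed

text \<open>Points on opposite sides of 0 are compared through u(0) = 0. The sides may come with
  different exponents; for distances at most 1 the smaller exponent gives the larger power.\<close>

lemma holder_across_0:
  fixes u :: "real \<Rightarrow> complex"
  assumes \<sigma>: "0 < \<sigma>1" "0 < \<sigma>2" and L: "0 \<le> L1" "0 \<le> L2" and \<eta>: "\<eta> \<le> 1 / 2" and u0: "u 0 = 0"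
    and p: "\<And>x. 0 < x \<Longrightarrow> x \<le> \<eta> \<Longrightarrow> norm (u x) \<le> L1 * x powr \<sigma>1"
      "\<And>x y. 0 < x \<Longrightarrow> x \<le> y \<Longrightarrow> y \<le> \<eta> \<Longrightarrow> norm (u x - u y) \<le> L1 * (y - x) powr \<sigma>1"
    and n: "\<And>x. 0 < x \<Longrightarrow> x \<le> \<eta> \<Longrightarrow> norm (u (- x)) \<le> L2 * x powr \<sigma>2"
      "\<And>x y. 0 < x \<Longrightarrow> x \<le> y \<Longrightarrow> y \<le> \<eta> \<Longrightarrow> norm (u (- x) - u (- y)) \<le> L2 * (y - x) powr \<sigma>2"
    and xs: "\<bar>x\<bar> \<le> \<eta>" "\<bar>s\<bar> \<le> \<eta>"
  shows "norm (u x - u s) \<le> (L1 + L2) * \<bar>x - s\<bar> powr min \<sigma>1 \<sigma>2"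
proof -
  define \<sigma> where "\<sigma> = min \<sigma>1 \<sigma>2"
  have \<sigma>': "0 < \<sigma>" "\<sigma> \<le> \<sigma>1" "\<sigma> \<le> \<sigma>2" using \<sigma> by (auto simp: \<sigma>_def)
  have pw: "L * d powr \<sigma>' \<le> L * \<bar>x - s\<bar> powr \<sigma>" if "0 \<le> L" "0 \<le> d" "d \<le> \<bar>x - s\<bar>" "\<bar>x - s\<bar> \<le> 1" "\<sigma> \<le> \<sigma>'" for L d x s \<sigma>'
  proof -
    have "d powr \<sigma>' \<le> d powr \<sigma>" using that by (intro powr_mono') auto
    also have "\<dots> \<le> \<bar>x - s\<bar> powr \<sigma>" using that \<sigma>' by (intro powr_mono2) auto
    finally show ?thesis using that by (intro mult_left_mono) auto
  qed
  have main: "norm (u x - u s) \<le> (L1 + L2) * \<bar>x - s\<bar> powr \<sigma>" if xs: "\<bar>x\<bar> \<le> \<eta>" "\<bar>s\<bar> \<le> \<eta>" "x \<le> s" for x s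
  proof -
    have d1: "\<bar>x - s\<bar> \<le> 1" using xs \<eta> by linarith
    have P: "0 \<le> L1 * \<bar>x - s\<bar> powr \<sigma>" "0 \<le> L2 * \<bar>x - s\<bar> powr \<sigma>" using L by auto
    consider "0 < x" | "s < 0" | "x = 0" "s = 0" | "x = 0" "0 < s" | "x < 0" "s = 0" | "x < 0" "0 < s" using xs by linarith
    then show ?thesis
    proof cases
      case 1
      have "norm (u x - u s) \<le> L1 * (s - x) powr \<sigma>1" using p(2)[of x s] 1 xs by auto
      also have "\<dots> \<le> L1 * \<bar>x - s\<bar> powr \<sigma>" using xs d1 L \<sigma>' by (intro pw) auto
      finally show ?thesis using P by (simp add: distrib_right)
    next
      case 2
      have "norm (u x - u s) \<le> L2 * (s - x) powr \<sigma>2" using n(2)[of "- s" "- x"] 2 xs by (auto simp: norm_minus_commute)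
      also have "\<dots> \<le> L2 * \<bar>x - s\<bar> powr \<sigma>" using xs d1 L \<sigma>' by (intro pw) auto
      finally show ?thesis using P by (simp add: distrib_right)
    next
      case 3 then show ?thesis using L by simp
    next
      case 4
      have "norm (u x - u s) \<le> L1 * s powr \<sigma>1" using p(1)[of s] 4 xs u0 by auto
      also have "\<dots> \<le> L1 * \<bar>x - s\<bar> powr \<sigma>" using 4 xs d1 L \<sigma>' by (intro pw) auto
      finally show ?thesis using P by (simp add: distrib_right)
    next
      case 5
      have "norm (u x - u s) \<le> L2 * (- x) powr \<sigma>2" using n(1)[of "- x"] 5 xs u0 by auto
      also have "\<dots> \<le> L2 * \<bar>x - s\<bar> powr \<sigma>" using 5 xs d1 L \<sigma>' by (intro pw) auto
      finally show ?thesis using P by (simp add: distrib_right)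
    next
      case 6
      have "norm (u x - u s) \<le> norm (u s) + norm (u x)" using norm_triangle_ineq4[of "u x" "u s"] by simp
      also have "\<dots> \<le> L1 * s powr \<sigma>1 + L2 * (- x) powr \<sigma>2"
        using p(1)[of s] n(1)[of "- x"] 6 xs by auto
      also have "\<dots> \<le> L1 * \<bar>x - s\<bar> powr \<sigma> + L2 * \<bar>x - s\<bar> powr \<sigma>"
        using 6 xs d1 L \<sigma>' by (intro add_mono pw) auto
      finally show ?thesis by (simp add: distrib_right)
    qed
  qed
  show ?thesis
    using main[of x s] main[of s x] xs unfolding \<sigma>_def
    by (cases "x \<le> s") (auto simp: norm_minus_commute abs_minus_commute)
qed

section \<open>Semi-classical weights\<close>

lemma circle_int_eq_integral: "circle_int f = integral {0..1} (\<lambda>t. f (circlepath 0 1 t))"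
  unfolding circle_int_def contour_integral_integral vector_derivative_circlepath
  by (simp add: circlepath)

lemma absolutely_integrable_circle_rotate:
  fixes f :: "complex \<Rightarrow> complex"
  assumes a: "norm a = 1" and f: "(\<lambda>t. f (circlepath 0 1 t)) absolutely_integrable_on {0..1}"
  shows "(\<lambda>x. f (a * cis (2 * pi * x))) absolutely_integrable_on {-1/2..1/2}"
proof -
  have "(\<lambda>t. norm (f (circlepath 0 1 t))) integrable_on {0..1}"
    using f by (simp add: absolutely_integrable_on_def)
  then obtain I where "((\<lambda>t. norm (f (circlepath 0 1 t))) has_integral I) {0..1}" by blast
  then have "((\<lambda>t. complex_of_real (norm (f (circlepath 0 1 t)))) has_integral of_real I) {0..1}"
    by (rule has_integral_of_real)
  from has_integral_linear[OF has_integral_circle_rotate[OF a, of "\<lambda>\<zeta>. of_real (norm (f \<zeta>))", OF this]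
      bounded_linear_Re]
  have "((\<lambda>x. norm (f (a * cis (2 * pi * x)))) has_integral I) {-1/2..1/2}"
    by (simp only: o_def Re_complex_of_real)
  then have "(\<lambda>x. norm (f (a * cis (2 * pi * x)))) integrable_on {-1/2..1/2}" by blast
  moreover obtain J where "((\<lambda>t. f (circlepath 0 1 t)) has_integral J) {0..1}"
    using f by (auto simp: absolutely_integrable_on_def)
  then have "(\<lambda>x. f (a * cis (2 * pi * x))) integrable_on {-1/2..1/2}"
    using has_integral_circle_rotate[OF a] by blast
  ultimately show ?thesis by (simp add: absolutely_integrable_on_def)
qed

text \<open>Pulled back along the circle, the j-th partial fraction of w' / w becomes \<rho>_j / x
  plus a bounded remainder, and the others are continuous at x = 0. A derivative within the circle
  suffices, since the path stays on it.\<close>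

lemma semiclassical_angular_ode:
  assumes sc: "regular_semiclassical M s \<rho> w" and j: "j \<le> M" and a: "norm (s j) = 1"
  obtains b \<eta> K where "0 < \<eta>"
    "\<And>x. x \<noteq> 0 \<Longrightarrow> \<bar>x\<bar> \<le> \<eta> \<Longrightarrow> norm (b x) \<le> K"
    "\<And>x. x \<noteq> 0 \<Longrightarrow> \<bar>x\<bar> \<le> \<eta> \<Longrightarrow> ((\<lambda>x. w (s j * cis (2 * pi * x))) has_vector_derivative
       (\<rho> j / of_real x + b x) * w (s j * cis (2 * pi * x))) (at x)"
proof -
  define e where "e x = s j * cis (2 * pi * x)" for x
  obtain V W E where inj: "inj_on s {..M}" and E: "finite E"
    and VW: "\<And>z. z \<notin> s ` {..M} \<Longrightarrow> 2 * poly V z / poly W z = (\<Sum>i\<le>M. \<rho> i / (z - s i))"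
    and der: "\<And>\<zeta>. \<zeta> \<in> sphere 0 1 - (E \<union> s ` {..M}) \<Longrightarrow>
      (w has_field_derivative 2 * poly V \<zeta> / poly W \<zeta> * w \<zeta>) (at \<zeta> within sphere 0 1)"
    using sc unfolding regular_semiclassical_def by blast
  have a0: "s j \<noteq> 0" using a by auto
  have e_sphere: "e x \<in> sphere 0 1" for x using a by (simp add: e_def norm_mult)
  have e_tendsto: "(e \<longlongrightarrow> s j) (at 0)"
  proof -
    have "isCont e 0" unfolding e_def cis_conv_exp by (intro continuous_intros)
    then show ?thesis by (simp add: isCont_def e_def)
  qed
  define b where "b x = \<rho> j * (2 * pi * \<i> * cis (2 * pi * x) / (cis (2 * pi * x) - 1) - 1 / of_real x)
      + (\<Sum>i\<in>{..M}-{j}. \<rho> i * (2 * pi * \<i> * e x) / (e x - s i))" for x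
  define l where "l = \<rho> j * (pi * \<i>) + (\<Sum>i\<in>{..M}-{j}. \<rho> i * (2 * pi * \<i> * s j) / (s j - s i))"
  have "(b \<longlongrightarrow> l) (at 0)"
    unfolding b_def l_def
    by (intro tendsto_intros cis_diff_quotient_tendsto e_tendsto) (use inj j in \<open>auto dest: inj_onD\<close>)
  then have "\<forall>\<^sub>F x in at 0. norm (b x) < norm l + 1"
    by (intro order_tendstoD(2)[OF tendsto_norm]) auto
  \<comment> \<open>\<open>s j\<close> is the limit of \<open>e\<close> and has to be taken out of
    the excluded set to leave a neighbourhood; it is avoided later because x \<noteq> 0.\<close>
  moreover have "\<forall>\<^sub>F x in at 0. e x \<in> - ((E \<union> s ` {..M}) - {s j})"
    using E by (intro topological_tendstoD[OF e_tendsto] open_Compl finite_imp_closed) auto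
  ultimately have "\<forall>\<^sub>F x in at 0. norm (b x) < norm l + 1 \<and> e x \<in> - ((E \<union> s ` {..M}) - {s j})"
    by (rule eventually_conj)
  then obtain d where d: "0 < d"
    "\<And>x. x \<noteq> 0 \<Longrightarrow> \<bar>x\<bar> < d \<Longrightarrow> norm (b x) < norm l + 1 \<and> e x \<in> - ((E \<union> s ` {..M}) - {s j})"
    unfolding eventually_at by (auto simp: dist_norm)
  define \<eta> where "\<eta> = min (d / 2) (1 / 2)"
  show thesis
  proof (rule that[of \<eta> b "norm l + 1"])
    show "0 < \<eta>" using d by (simp add: \<eta>_def)
    fix x :: real assume x: "x \<noteq> 0" "\<bar>x\<bar> \<le> \<eta>"
    then have x': "\<bar>x\<bar> < d" "\<bar>x\<bar> \<le> 1 / 2" using d by (auto simp: \<eta>_def)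
    show "norm (b x) \<le> norm l + 1" using d(2)[OF x(1) x'(1)] by simp
    have "0 < norm (cis (2 * pi * x) - cis (2 * pi * 0))"
      unfolding norm_cis_diff using sin_pi_ge[OF x'(2)] x by auto
    then have c: "cis (2 * pi * x) \<noteq> 1" by auto
    then have "e x \<noteq> s j" using a0 by (simp add: e_def)
    then have ex: "e x \<in> sphere 0 1 - (E \<union> s ` {..M})" using d(2)[OF x(1) x'(1)] e_sphere by auto
    have "(e has_vector_derivative 2 * pi * \<i> * e x) (at x)"
    proof -
      have e: "e = (\<lambda>x. s j * circlepath 0 1 x)"
        by (simp add: e_def circlepath cis_conv_exp mult_ac fun_eq_iff)
      show ?thesis
        using has_vector_derivative_mult_right[OF has_vector_derivative_circlepath[of 0 1 x UNIV], of "s j"]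
        unfolding e by (simp add: circlepath mult_ac)
    qed
    then have "(w \<circ> e has_vector_derivative (2 * pi * \<i> * e x) * (2 * poly V (e x) / poly W (e x) * w (e x))) (at x)"
      using der[OF ex] e_sphere by (intro field_vector_diff_chain_within) (auto intro: DERIV_subset)
    moreover have "2 * pi * \<i> * e x * (2 * poly V (e x) / poly W (e x) * w (e x)) = (\<rho> j / of_real x + b x) * w (e x)"
    proof -
      have "2 * pi * \<i> * e x * (2 * poly V (e x) / poly W (e x)) = (\<Sum>i\<le>M. \<rho> i * (2 * pi * \<i> * e x) / (e x - s i))"
        using ex by (subst VW) (auto simp: sum_distrib_left mult_ac)
      also have "\<dots> = \<rho> j * (2 * pi * \<i> * e x) / (e x - s j) + (\<Sum>i\<in>{..M}-{j}. \<rho> i * (2 * pi * \<i> * e x) / (e x - s i))"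
        using j by (intro sum.remove) auto
      also have "\<rho> j * (2 * pi * \<i> * e x) / (e x - s j) = \<rho> j * (2 * pi * \<i> * cis (2 * pi * x) / (cis (2 * pi * x) - 1))"
      proof -
        have "e x - s j = s j * (cis (2 * pi * x) - 1)" by (simp add: e_def algebra_simps)
        then show ?thesis using a0 c by (simp add: e_def)
      qed
      also have "\<rho> j * (2 * pi * \<i> * cis (2 * pi * x) / (cis (2 * pi * x) - 1))
          + (\<Sum>i\<in>{..M}-{j}. \<rho> i * (2 * pi * \<i> * e x) / (e x - s i)) = \<rho> j / of_real x + b x"
        by (simp add: b_def right_diff_distrib)
      finally show ?thesis by (simp only: mult.assoc[symmetric])
    qed
    ultimately show "((\<lambda>x. w (s j * cis (2 * pi * x))) has_vector_derivative
       (\<rho> j / of_real x + b x) * w (s j * cis (2 * pi * x))) (at x)"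
      unfolding o_def e_def by (simp only:)
  qed
qed

text \<open>The value 0 at x = 0 is the continuous extension, as \<open>w\<close> is arbitrary at
  the singular point itself. Integrability of w / (z - z_j) supplies the function dominating |w| /
  |x|.\<close>

lemma semiclassical_holder:
  assumes sc: "regular_semiclassical M s \<rho> w" and j: "j \<le> M" and a: "norm (s j) = 1"
    and int: "moments_exist (\<lambda>z. inverse (z - s j) * w z)"
  obtains \<sigma> L \<eta> where "0 < \<sigma>" "0 \<le> L" "0 < \<eta>" "\<eta> \<le> 1 / 4"
    "\<And>x y. \<bar>x\<bar> \<le> \<eta> \<Longrightarrow> \<bar>y\<bar> \<le> \<eta> \<Longrightarrow>
       norm ((if x = 0 then 0 else w (s j * cis (2 * pi * x))) - (if y = 0 then 0 else w (s j * cis (2 * pi * y))))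
         \<le> L * \<bar>x - y\<bar> powr \<sigma>"
proof -
  define v where "v x = w (s j * cis (2 * pi * x))" for x
  define u where "u x = (if x = 0 then 0 else v x)" for x
  obtain b \<eta> K where b: "0 < \<eta>" "\<And>x. x \<noteq> 0 \<Longrightarrow> \<bar>x\<bar> \<le> \<eta> \<Longrightarrow> norm (b x) \<le> K"
    "\<And>x. x \<noteq> 0 \<Longrightarrow> \<bar>x\<bar> \<le> \<eta> \<Longrightarrow> (v has_vector_derivative (\<rho> j / of_real x + b x) * v x) (at x)"
    using semiclassical_angular_ode[OF sc j a] unfolding v_def by metis
  define \<eta>' where "\<eta>' = min \<eta> (1 / 2)"
  have \<eta>': "0 < \<eta>'" "\<eta>' \<le> \<eta>" "\<eta>' \<le> 1 / 2" using b by (auto simp: \<eta>'_def)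
  \<comment> \<open>The factor 2 \<pi> comes from the chord bound |z_j cis (2 \<pi> x) - z_j| \<le>
    2 \<pi> |x|.\<close>
  define f where "f x = 2 * pi * norm (inverse (s j * cis (2 * pi * x) - s j) * v x)" for x
  have "(\<lambda>x. inverse (s j * cis (2 * pi * x) - s j) * v x) absolutely_integrable_on {-1/2..1/2}"
    using int unfolding moments_exist_def v_def
    by (rule absolutely_integrable_circle_rotate[OF a, of "\<lambda>z. inverse (z - s j) * w z"])
  then have f_int: "f integrable_on {-1/2..1/2}"
    unfolding f_def absolutely_integrable_on_def by (intro integrable_on_mult_right) auto
  have f_ge: "norm (v x) / \<bar>x\<bar> \<le> f x" if x: "x \<noteq> 0" "\<bar>x\<bar> \<le> 1 / 2" for x
  proof -
    have "norm (s j * cis (2 * pi * x) - s j) = norm (s j) * norm (cis (2 * pi * x) - cis (2 * pi * 0))"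
      by (simp add: algebra_simps flip: norm_mult)
    then have n: "norm (s j * cis (2 * pi * x) - s j) = 2 * \<bar>sin (pi * x)\<bar>"
      using a norm_cis_diff[of x 0] by simp
    have "2 * \<bar>sin (pi * x)\<bar> \<le> 2 * pi * \<bar>x\<bar>"
      using abs_sin_x_le_abs_x[of "pi * x"] by (simp add: abs_mult)
    moreover have "0 < \<bar>sin (pi * x)\<bar>" using sin_pi_ge[OF x(2)] x by auto
    ultimately have "norm (v x) * inverse (2 * pi * \<bar>x\<bar>) \<le> norm (v x) * inverse (2 * \<bar>sin (pi * x)\<bar>)"
      by (intro mult_left_mono le_imp_inverse_le) auto
    then show ?thesis
      unfolding f_def norm_mult norm_inverse n using x by (simp add: field_simps)
  qed
  \<comment> \<open>\<tau> = -1 reflects the left side onto x > 0. The singular term keeps its form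
    because dx and 1/x both change sign; only the bounded term acquires \<tau>.\<close>
  have side: "\<exists>\<sigma> L. 0 < \<sigma> \<and> 0 \<le> L \<and>
      (\<forall>x. 0 < x \<and> x < \<eta>' \<longrightarrow> norm (v (\<tau> * x)) \<le> L * x powr \<sigma>) \<and>
      (\<forall>x y. 0 < x \<and> x \<le> y \<and> y < \<eta>' \<longrightarrow> norm (v (\<tau> * x) - v (\<tau> * y)) \<le> L * (y - x) powr \<sigma>)"
    if \<tau>: "\<tau> = 1 \<or> \<tau> = - 1" for \<tau> :: real
  proof -
    obtain \<sigma> L where "0 < \<sigma>" "\<sigma> \<le> 1" "0 \<le> L"
      "\<And>x. 0 < x \<Longrightarrow> x < \<eta>' \<Longrightarrow> norm (v (\<tau> * x)) \<le> L * x powr \<sigma>"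
      "\<And>x y. 0 < x \<Longrightarrow> x \<le> y \<Longrightarrow> y < \<eta>' \<Longrightarrow> norm (v (\<tau> * x) - v (\<tau> * y)) \<le> L * (y - x) powr \<sigma>"
    proof (rule ode_singular_holder[of \<eta>' "\<lambda>x. v (\<tau> * x)" "\<rho> j" "\<lambda>x. \<tau> * b (\<tau> * x)" K "\<lambda>x. f (\<tau> * x)"])
      fix x :: real assume x: "0 < x" "x \<le> \<eta>'"
      then have tx: "\<tau> * x \<noteq> 0" "\<bar>\<tau> * x\<bar> \<le> \<eta>'" "\<bar>\<tau> * x\<bar> = x" using \<tau> by auto
      have "((v \<circ> (\<lambda>x. \<tau> * x)) has_vector_derivative \<tau> *\<^sub>R ((\<rho> j / of_real (\<tau> * x) + b (\<tau> * x)) * v (\<tau> * x))) (at x)"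
        using tx \<eta>' by (intro vector_diff_chain_at b) (auto intro!: derivative_eq_intros)
      moreover have "\<tau> *\<^sub>R ((\<rho> j / of_real (\<tau> * x) + b (\<tau> * x)) * v (\<tau> * x))
          = (\<rho> j / of_real x + \<tau> * b (\<tau> * x)) * v (\<tau> * x)"
        using \<tau> x by (auto simp: algebra_simps scaleR_conv_of_real)
      ultimately show "((\<lambda>x. v (\<tau> * x)) has_vector_derivative (\<rho> j / of_real x + \<tau> * b (\<tau> * x)) * v (\<tau> * x)) (at x)"
        by (simp add: o_def)
      show "norm (\<tau> * b (\<tau> * x)) \<le> K" using b(2)[of "\<tau> * x"] tx \<eta>' \<tau> by (auto simp: norm_mult)
      show "norm (v (\<tau> * x)) / x \<le> f (\<tau> * x)" using f_ge[of "\<tau> * x"] tx \<eta>' by auto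
    next
      have "f integrable_on {0..\<eta>'}" "f integrable_on {-\<eta>'..0}"
        using \<eta>' by (auto intro: integrable_subinterval_real[OF f_int])
      then show "(\<lambda>x. f (\<tau> * x)) integrable_on {0..\<eta>'}"
        using \<tau> Henstock_Kurzweil_Integration.integrable_reflect_real[where f = f and a = "- \<eta>'" and b = 0] by auto
    qed (use \<eta>' in \<open>auto simp: f_def\<close>)
    then show ?thesis by blast
  qed
  obtain \<sigma>1 L1 where 1: "0 < \<sigma>1" "0 \<le> L1"
    "\<And>x. 0 < x \<Longrightarrow> x < \<eta>' \<Longrightarrow> norm (v x) \<le> L1 * x powr \<sigma>1"
    "\<And>x y. 0 < x \<Longrightarrow> x \<le> y \<Longrightarrow> y < \<eta>' \<Longrightarrow> norm (v x - v y) \<le> L1 * (y - x) powr \<sigma>1"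
    using side[of 1] by auto
  obtain \<sigma>2 L2 where 2: "0 < \<sigma>2" "0 \<le> L2"
    "\<And>x. 0 < x \<Longrightarrow> x < \<eta>' \<Longrightarrow> norm (v (- x)) \<le> L2 * x powr \<sigma>2"
    "\<And>x y. 0 < x \<Longrightarrow> x \<le> y \<Longrightarrow> y < \<eta>' \<Longrightarrow> norm (v (- x) - v (- y)) \<le> L2 * (y - x) powr \<sigma>2"
    using side[of "- 1"] by auto
  \<comment> \<open>Halving \<eta>' makes closed ranges out of the strict bounds x <
    \<eta>'.\<close>
  have hol: "norm (u x - u y) \<le> (L1 + L2) * \<bar>x - y\<bar> powr min \<sigma>1 \<sigma>2" if "\<bar>x\<bar> \<le> \<eta>' / 2" "\<bar>y\<bar> \<le> \<eta>' / 2" for x y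
    by (rule holder_across_0[where \<eta> = "\<eta>' / 2"]) (use 1 2 \<eta>' that in \<open>auto simp: u_def\<close>)
  show thesis
  proof (rule that[of "min \<sigma>1 \<sigma>2" "L1 + L2" "\<eta>' / 2"])
    fix x y assume "\<bar>x\<bar> \<le> \<eta>' / 2" "\<bar>y\<bar> \<le> \<eta>' / 2"
    then show "norm ((if x = 0 then 0 else w (s j * cis (2 * pi * x))) - (if y = 0 then 0 else w (s j * cis (2 * pi * y))))
         \<le> (L1 + L2) * \<bar>x - y\<bar> powr min \<sigma>1 \<sigma>2"
      by (rule hol[unfolded u_def v_def])
  qed (use 1 2 \<eta>' in auto)
qed

lemma weight_cauchy_limit:
  assumes sc: "regular_semiclassical M s \<rho> w" and j: "j \<le> M" and a: "norm (s j) = 1"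
    and w: "moments_exist w" and int: "moments_exist (\<lambda>z. inverse (z - s j) * w z)"
  shows "((\<lambda>z. circle_int (\<lambda>\<zeta>. w \<zeta> * inverse (\<zeta> - z))) \<longlongrightarrow> circle_int (\<lambda>\<zeta>. w \<zeta> * inverse (\<zeta> - s j)))
    (at (s j) within - sphere 0 1)"
proof -
  define e where "e x = s j * cis (2 * pi * x)" for x
  define u where "u x = (if x = 0 then 0 else w (s j * cis (2 * pi * x)))" for x
  obtain \<sigma> L \<eta> where h: "0 < \<sigma>" "0 \<le> L" "0 < \<eta>" "\<eta> \<le> 1 / 4"
    "\<And>x y. \<bar>x\<bar> \<le> \<eta> \<Longrightarrow> \<bar>y\<bar> \<le> \<eta> \<Longrightarrow> norm (u x - u y) \<le> L * \<bar>x - y\<bar> powr \<sigma>"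
    unfolding u_def by (rule semiclassical_holder[OF sc j a int]) blast
  have spike: "negligible {0::real}" by simp
  have wi: "(\<lambda>x. w (e x)) absolutely_integrable_on {-1/2..1/2}"
    using w unfolding moments_exist_def e_def by (rule absolutely_integrable_circle_rotate[OF a])
  have u_int: "u absolutely_integrable_on {-1/2..1/2}"
    by (rule absolutely_integrable_spike[OF wi spike]) (auto simp: u_def e_def)
  have qi: "(\<lambda>x. inverse (e x - s j) * w (e x)) absolutely_integrable_on {-1/2..1/2}"
    using int unfolding moments_exist_def e_def
    by (rule absolutely_integrable_circle_rotate[OF a, of "\<lambda>z. inverse (z - s j) * w z"])
  have uq: "(\<lambda>x. u x * inverse (e x - s j)) integrable_on {-1/2..1/2}"
    by (rule integrable_spike[OF set_lebesgue_integral_eq_integral(1)[OF qi] spike]) (auto simp: u_def e_def)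
  have lim: "((\<lambda>z. integral {-1/2..1/2} (\<lambda>x. u x * inverse (e x - z))) \<longlongrightarrow>
      integral {-1/2..1/2} (\<lambda>x. u x * inverse (e x - s j))) (at (s j) within - sphere 0 1)"
    unfolding e_def
    by (rule cauchy_integral_limit[OF a u_int _ h(1,3,4,2)]) (use uq h in \<open>auto simp: e_def u_def\<close>)
  have eq: "circle_int (\<lambda>\<zeta>. w \<zeta> * inverse (\<zeta> - z)) = integral {-1/2..1/2} (\<lambda>x. u x * inverse (e x - z))"
    if "(\<lambda>t. w (circlepath 0 1 t) * inverse (circlepath 0 1 t - z)) absolutely_integrable_on {0..1}" for z
  proof -
    have "((\<lambda>t. w (circlepath 0 1 t) * inverse (circlepath 0 1 t - z)) has_integral
        circle_int (\<lambda>\<zeta>. w \<zeta> * inverse (\<zeta> - z))) {0..1}"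
      unfolding circle_int_eq_integral using that by (intro integrable_integral set_lebesgue_integral_eq_integral(1))
    from has_integral_circle_rotate[OF a, of "\<lambda>\<zeta>. w \<zeta> * inverse (\<zeta> - z)", OF this]
    have "circle_int (\<lambda>\<zeta>. w \<zeta> * inverse (\<zeta> - z)) = integral {-1/2..1/2} (\<lambda>x. w (e x) * inverse (e x - z))"
      unfolding e_def by (rule integral_unique[symmetric])
    also have "\<dots> = integral {-1/2..1/2} (\<lambda>x. u x * inverse (e x - z))"
      by (rule integral_spike[OF spike]) (auto simp: u_def e_def)
    finally show ?thesis .
  qed
  have eq1: "circle_int (\<lambda>\<zeta>. w \<zeta> * inverse (\<zeta> - s j)) = integral {-1/2..1/2} (\<lambda>x. u x * inverse (e x - s j))"
    using int by (intro eq) (simp add: moments_exist_def mult.commute)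
  have eq2: "circle_int (\<lambda>\<zeta>. w \<zeta> * inverse (\<zeta> - z)) = integral {-1/2..1/2} (\<lambda>x. u x * inverse (e x - z))"
    if "z \<in> - sphere 0 1" for z
  proof (rule eq, rule absolutely_integrable_mult_continuous)
    have "circlepath 0 1 t - z \<noteq> 0" if "t \<in> {0..1}" for t
      using path_image_circlepath_nonneg[of 1 0] that \<open>z \<in> _\<close> by (auto simp: path_image_def)
    then show "continuous_on {0..1} (\<lambda>t. inverse (circlepath 0 1 t - z))"
      using path_circlepath[of 0 1] unfolding path_def by (intro continuous_intros) auto
  qed (use w in \<open>simp add: moments_exist_def\<close>)
  show ?thesis
    unfolding eq1 by (rule Lim_transform_within[OF lim, where d = 1]) (simp_all add: eq2)
qed

section \<open>The moment functional of a weight\<close>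

lemma continuous_on_circle_param:
  assumes "continuous_on (sphere 0 1) f"
  shows "continuous_on {0..1} (\<lambda>t. f (circlepath 0 1 t))"
proof (rule continuous_on_compose2[OF assms])
  show "continuous_on {0..1} (circlepath 0 1 :: real \<Rightarrow> complex)"
    using path_circlepath[of 0 1] by (simp add: path_def)
  show "circlepath 0 1 ` {0..1} \<subseteq> sphere 0 1"
    using path_image_circlepath_nonneg[of 1 0] by (simp add: path_image_def)
qed

lemma moments_exist_mult_continuous:
  assumes "moments_exist w" "continuous_on (sphere 0 1) f"
  shows "moments_exist (\<lambda>\<zeta>. w \<zeta> * f \<zeta>)"
  using assms continuous_on_circle_param unfolding moments_exist_def
  by (intro absolutely_integrable_mult_continuous) auto

lemma circle_int_cmult: "circle_int (\<lambda>\<zeta>. c * f \<zeta>) = c * circle_int f"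
  by (simp add: circle_int_eq_integral)

lemma circle_int_add:
  assumes "moments_exist f" "moments_exist g"
  shows "circle_int (\<lambda>\<zeta>. f \<zeta> + g \<zeta>) = circle_int f + circle_int g"
  unfolding circle_int_eq_integral
  by (rule Henstock_Kurzweil_Integration.integral_add)
     (use assms in \<open>auto simp: moments_exist_def absolutely_integrable_on_def\<close>)

lemma circle_int_cong:
  assumes "\<And>\<zeta>. norm \<zeta> = 1 \<Longrightarrow> \<zeta> \<noteq> p \<Longrightarrow> f \<zeta> = g \<zeta>"
  shows "circle_int f = circle_int g"
proof -
  have "finite {t \<in> {0..1}. circlepath 0 1 t = p}"
  proof (cases "\<exists>t0 \<in> {0..1}. circlepath 0 1 t0 = p")
    case True
    then obtain t0 where t0: "t0 \<in> {0..1}" "circlepath 0 1 t0 = p" by blast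
    have "simple_path (circlepath 0 1)" by (simp add: simple_path_circlepath)
    then have "t = 0 \<or> t = 1 \<or> t = t0" if "t \<in> {0..1}" "circlepath 0 1 t = p" for t
      using t0 that unfolding simple_path_def loop_free_def by blast
    then have "{t \<in> {0..1}. circlepath 0 1 t = p} \<subseteq> {0, 1, t0}" by blast
    then show ?thesis by (rule finite_subset) simp
  next
    case False
    then have "{t \<in> {0..1}. circlepath 0 1 t = p} = {}" by blast
    then show ?thesis by (simp only: finite.emptyI)
  qed
  then have "negligible {t \<in> {0..1}. circlepath 0 1 t = p}" by (rule negligible_finite)
  then show ?thesis
    unfolding circle_int_eq_integral
  proof (rule integral_spike)
    fix t :: real assume t: "t \<in> {0..1} - {t \<in> {0..1}. circlepath 0 1 t = p}"
    then have "circlepath 0 1 t \<in> path_image (circlepath 0 1)" unfolding path_image_def by blast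
    then have "norm (circlepath 0 1 t) = 1" by simp
    then show "g (circlepath 0 1 t) = f (circlepath 0 1 t)" using assms t by auto
  qed
qed

definition wmom :: "(complex \<Rightarrow> complex) \<Rightarrow> int \<Rightarrow> complex poly \<Rightarrow> complex" where
  "wmom w k p = circle_int (\<lambda>\<zeta>. w \<zeta> * (\<zeta> powi k * poly p \<zeta>))"

definition wpair :: "(complex \<Rightarrow> complex) \<Rightarrow> complex poly \<Rightarrow> complex poly \<Rightarrow> complex" where
  "wpair w p q = circle_int (\<lambda>\<zeta>. w \<zeta> * (poly p \<zeta> * poly q (1 / \<zeta>)))"

lemma circle_int_weight_add:
  assumes "moments_exist w" "continuous_on (sphere 0 1) f" "continuous_on (sphere 0 1) g"
  shows "circle_int (\<lambda>\<zeta>. w \<zeta> * (f \<zeta> + g \<zeta>)) = circle_int (\<lambda>\<zeta>. w \<zeta> * f \<zeta>) + circle_int (\<lambda>\<zeta>. w \<zeta> * g \<zeta>)"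
  unfolding distrib_left using assms by (intro circle_int_add moments_exist_mult_continuous)

lemma circle_int_weight_cmult: "circle_int (\<lambda>\<zeta>. w \<zeta> * (c * f \<zeta>)) = c * circle_int (\<lambda>\<zeta>. w \<zeta> * f \<zeta>)"
  unfolding mult.left_commute[of _ c] by (rule circle_int_cmult)

lemma continuous_on_sphere_poly_inverse:
  "continuous_on (sphere 0 1) (\<lambda>\<zeta>::complex. poly q (1 / \<zeta>))"
  by (intro continuous_on_poly continuous_intros) auto

lemma continuous_on_sphere_powi:
  "continuous_on (sphere 0 1) (\<lambda>\<zeta>::complex. \<zeta> powi k)"
  by (intro continuous_intros) auto

lemma moment_functional_wmom:
  assumes "moments_exist w"
  shows "moment_functional (wmom w)"
proof
  fix k p q and c :: complex
  show "wmom w k (p + q) = wmom w k p + wmom w k q"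
    unfolding wmom_def poly_add distrib_left[of "_ powi _"]
    by (intro circle_int_weight_add assms continuous_on_mult continuous_on_sphere_powi continuous_intros)
  show "wmom w k (Polynomial.smult c p) = c * wmom w k p"
    unfolding wmom_def poly_smult mult.left_commute[of "_ powi _" c] by (rule circle_int_weight_cmult)
  show "wmom w k (pCons 0 p) = wmom w (k + 1) p"
    unfolding wmom_def by (rule circle_int_cong[of 0]) (simp add: power_int_add mult_ac)
qed

lemma wpair_add_left:
  assumes "moments_exist w"
  shows "wpair w (p + q) s = wpair w p s + wpair w q s"
  unfolding wpair_def poly_add distrib_right
  by (intro circle_int_weight_add assms continuous_on_mult continuous_on_sphere_poly_inverse continuous_intros)

lemma wpair_add_right:
  assumes "moments_exist w"
  shows "wpair w s (p + q) = wpair w s p + wpair w s q"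
  unfolding wpair_def poly_add distrib_left[of "poly _ _"]
  by (intro circle_int_weight_add assms continuous_on_mult continuous_on_sphere_poly_inverse continuous_intros)

lemma wpair_smult_left: "wpair w (Polynomial.smult c p) s = c * wpair w p s"
  unfolding wpair_def poly_smult mult.assoc by (rule circle_int_weight_cmult)

lemma wpair_smult_right: "wpair w s (Polynomial.smult c p) = c * wpair w s p"
  unfolding wpair_def poly_smult mult.left_commute[of "poly _ _" c] by (rule circle_int_weight_cmult)

lemma wpair_monom: "wpair w p (Polynomial.monom 1 k) = wmom w (- int k) p"
  unfolding wpair_def wmom_def
  by (rule arg_cong[of _ _ circle_int]) (simp add: fun_eq_iff poly_monom power_int_minus power_one_over inverse_eq_divide)

text \<open>On the circle \<zeta>^(-k) times the reversed polynomial is \<zeta>^(deg q - k)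
  q(1/\<zeta>). Pairing \<open>\<phi>b n\<close> with the powers below n thus yields the relations
  of \<Psi>_n at indices -1, ..., -n.\<close>

lemma wmom_reflect_poly:
  assumes "k \<le> degree q"
  shows "wmom w (- int k) (reflect_poly q) = wpair w (Polynomial.monom 1 (degree q - k)) q"
  unfolding wpair_def wmom_def
proof (rule circle_int_cong[of 0])
  fix \<zeta> :: complex assume "\<zeta> \<noteq> 0"
  then show "w \<zeta> * (\<zeta> powi (- int k) * poly (reflect_poly q) \<zeta>)
      = w \<zeta> * (poly (Polynomial.monom 1 (degree q - k)) \<zeta> * poly q (1 / \<zeta>))"
    using assms by (simp add: poly_reflect_poly_nz poly_monom power_int_minus power_diff inverse_eq_divide)
qed

text \<open>Leading terms are removed one at a time by multiples of \<open>P m\<close>, which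
  therefore span the polynomials of degree below \<open>n\<close>. It is applied to \<phi>, to
  \<open>\<phi>b\<close> and to the monomials.\<close>

lemma triangular_vanish:
  fixes F :: "'a::field poly \<Rightarrow> 'a"
  assumes add: "\<And>p q. F (p + q) = F p + F q" and smult: "\<And>c p. F (Polynomial.smult c p) = c * F p"
    and P: "\<And>m. coeff (P m) m \<noteq> 0" "\<And>m i. m < i \<Longrightarrow> coeff (P m) i = 0"
    and F: "\<And>m. m < n \<Longrightarrow> F (P m) = 0" and q: "\<And>i. n \<le> i \<Longrightarrow> coeff q i = 0"
  shows "F q = 0"
  using F q
proof (induction n arbitrary: q)
  case 0
  then have "q = Polynomial.smult 0 q" by (simp add: poly_eq_iff)
  then show ?case using smult[of 0 q] by simp
next
  case (Suc n)
  define c where "c = coeff q n / coeff (P n) n"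
  define q' where "q' = q - Polynomial.smult c (P n)"
  have "F q' = 0"
  proof (rule Suc.IH)
    fix i assume "n \<le> i"
    then show "coeff q' i = 0"
      using P Suc.prems(2)[of i] by (cases "i = n") (auto simp: q'_def c_def)
  qed (use Suc.prems in simp)
  moreover have "q = q' + Polynomial.smult c (P n)" by (simp add: q'_def)
  ultimately show ?case using Suc.prems(1)[of n] by (simp add: add smult)
qed

section \<open>The bi-orthogonal system as a Szego system\<close>

locale biorthogonal =
  fixes w :: "complex \<Rightarrow> complex" and \<kappa> :: "nat \<Rightarrow> complex" and \<phi> \<phi>b :: "nat \<Rightarrow> complex poly"
  assumes system: "biorthogonal_system w \<kappa> \<phi> \<phi>b"
begin

lemma moments: "moments_exist w"
  using system by (simp add: biorthogonal_system_def)

lemma degree_phi: "degree (\<phi> n) = n" "coeff (\<phi> n) n = \<kappa> n"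
proof -
  have *: "degree (\<phi> n) = n" "lead_coeff (\<phi> n) = \<kappa> n"
    using system unfolding biorthogonal_system_def by blast+
  then show "degree (\<phi> n) = n" "coeff (\<phi> n) n = \<kappa> n" by simp_all
qed

lemma degree_phib: "degree (\<phi>b n) = n" "coeff (\<phi>b n) n = \<kappa> n"
proof -
  have *: "degree (\<phi>b n) = n" "lead_coeff (\<phi>b n) = \<kappa> n"
    using system unfolding biorthogonal_system_def by blast+
  then show "degree (\<phi>b n) = n" "coeff (\<phi>b n) n = \<kappa> n" by simp_all
qed

lemma wpair_phi: "wpair w (\<phi> m) (\<phi>b n) = (if m = n then 1 else 0)"
  using system unfolding biorthogonal_system_def wpair_def mult.assoc by blast

lemma kappa_nz: "\<kappa> n \<noteq> 0"
proof
  assume "\<kappa> n = 0"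
  then have "lead_coeff (\<phi> n) = 0" using degree_phi[of n] by simp
  then have "wpair w (\<phi> n) (\<phi>b n) = wpair w (Polynomial.smult 0 0) (\<phi>b n)" by simp
  then show False unfolding wpair_smult_left by (simp add: wpair_phi)
qed

lemma wpair_phi_eq_0:
  assumes "\<And>i. n \<le> i \<Longrightarrow> coeff q i = 0"
  shows "wpair w (\<phi> n) q = 0" and "wpair w q (\<phi>b n) = 0"
proof -
  show "wpair w (\<phi> n) q = 0"
    by (rule triangular_vanish[where F = "wpair w (\<phi> n)" and P = \<phi>b and n = n])
       (use assms kappa_nz degree_phib in \<open>auto simp: wpair_add_right[OF moments] wpair_smult_right wpair_phi coeff_eq_0\<close>)
  show "wpair w q (\<phi>b n) = 0"
    by (rule triangular_vanish[where F = "\<lambda>q. wpair w q (\<phi>b n)" and P = \<phi> and n = n])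
       (use assms kappa_nz degree_phi in \<open>auto simp: wpair_add_left[OF moments] wpair_smult_left wpair_phi coeff_eq_0\<close>)
qed

definition "\<Phi> n = Polynomial.smult (1 / \<kappa> n) (\<phi> n)"
definition "\<Psi> n = Polynomial.smult (1 / \<kappa> n) (reflect_poly (\<phi>b n))"

sublocale szego "wmom w" \<Phi> \<Psi>
proof -
  interpret moment_functional "wmom w" by (rule moment_functional_wmom[OF moments])
  show "szego (wmom w) \<Phi> \<Psi>"
  proof
    fix n i :: nat
    show "coeff (\<Phi> n) n = 1" "coeff (\<Psi> n) 0 = 1"
      using kappa_nz by (simp_all add: \<Phi>_def \<Psi>_def degree_phi degree_phib)
    show "coeff (\<Phi> n) i = 0" if "n < i"
      using that by (simp add: \<Phi>_def coeff_eq_0 degree_phi)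
    show "coeff (\<Psi> n) i = 0" if "n < i"
      using that by (simp add: \<Psi>_def coeff_reflect_poly degree_phib)
  next
    fix k n :: nat assume "k < n"
    then show "wmom w (- int k) (\<Phi> n) = 0"
      by (simp add: \<Phi>_def wpair_smult_left wpair_phi_eq_0 flip: wpair_monom)
  next
    fix k n :: nat assume "1 \<le> k" "k \<le> n"
    then show "wmom w (- int k) (\<Psi> n) = 0"
      by (simp add: \<Psi>_def L_smult wmom_reflect_poly degree_phib wpair_phi_eq_0)
  next
    fix n :: nat and q :: "complex poly"
    assume q: "\<And>i. n \<le> i \<Longrightarrow> coeff q i = 0" "\<And>k. k < n \<Longrightarrow> wmom w (- int k) q = 0"
    have 0: "wpair w q p = 0" if "\<And>i. n \<le> i \<Longrightarrow> coeff p i = 0" for p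
      by (rule triangular_vanish[where F = "wpair w q" and P = "Polynomial.monom 1" and n = n])
         (use q that in \<open>auto simp: wpair_add_right[OF moments] wpair_smult_right wpair_monom\<close>)
    show "q = 0"
    proof (rule ccontr)
      assume "q \<noteq> 0"
      define d where "d = degree q"
      have "coeff q d \<noteq> 0" using \<open>q \<noteq> 0\<close> by (simp add: d_def)
      then have d: "d < n" using q(1) by (meson not_less)
      \<comment> \<open>Pairing \<open>q\<close> with \<open>\<phi>b d\<close> isolates its leading
        coefficient: lower degrees are annihilated and the multiple of \<open>\<phi> d\<close>
        contributes \<open>c\<close>. As d < n, the same pairing is 0.\<close>
      define c where "c = coeff q d / \<kappa> d"
      have "wpair w (q - Polynomial.smult c (\<phi> d)) (\<phi>b d) = 0"
      proof (rule wpair_phi_eq_0)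
        fix i assume "d \<le> i"
        then show "coeff (q - Polynomial.smult c (\<phi> d)) i = 0"
          using kappa_nz by (cases "i = d") (auto simp: c_def d_def degree_phi coeff_eq_0)
      qed
      moreover have "wpair w q (\<phi>b d) = 0" using d by (intro 0) (simp add: coeff_eq_0 degree_phib)
      moreover have "wpair w q (\<phi>b d) = wpair w (q - Polynomial.smult c (\<phi> d)) (\<phi>b d) + c * wpair w (\<phi> d) (\<phi>b d)"
        by (simp flip: wpair_add_left[OF moments] wpair_smult_left)
      ultimately have "c = 0" by (simp add: wpair_phi)
      with \<open>coeff q d \<noteq> 0\<close> kappa_nz show False by (simp add: c_def)
    qed
  qed
qed

text \<open>Only the leading term \<kappa>_n z^n of \<open>\<phi>b n\<close> contributes to its
  pairing with \<open>\<phi> n\<close>, which is 1.\<close>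

lemma wmom_Phi_lead: "wmom w (- int n) (\<Phi> n) = 1 / (\<kappa> n)\<^sup>2"
proof -
  have "wpair w (\<phi> n) (\<phi>b n - Polynomial.smult (\<kappa> n) (Polynomial.monom 1 n)) = 0"
  proof (rule wpair_phi_eq_0)
    fix i assume "n \<le> i"
    then show "coeff (\<phi>b n - Polynomial.smult (\<kappa> n) (Polynomial.monom 1 n)) i = 0"
      by (cases "i = n") (auto simp: degree_phib coeff_eq_0)
  qed
  moreover have "wpair w (\<phi> n) (\<phi>b n) = wpair w (\<phi> n) (\<phi>b n - Polynomial.smult (\<kappa> n) (Polynomial.monom 1 n))
      + \<kappa> n * wpair w (\<phi> n) (Polynomial.monom 1 n)"
    by (simp flip: wpair_add_right[OF moments] wpair_smult_right)
  ultimately have "\<kappa> n * wmom w (- int n) (\<phi> n) = 1" by (simp add: wpair_phi wpair_monom)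
  then show ?thesis using kappa_nz[of n] by (simp add: \<Phi>_def L_smult power2_eq_square field_simps)
qed

lemma kappa_Suc: "(\<kappa> (Suc n))\<^sup>2 * (1 - r (Suc n) * rb (Suc n)) = (\<kappa> n)\<^sup>2"
  using norm_Suc[of n] kappa_nz[of n] kappa_nz[of "Suc n"] unfolding wmom_Phi_lead by (simp add: field_simps)

lemma phi_eq: "\<phi> n = Polynomial.smult (\<kappa> n) (\<Phi> n)"
  using kappa_nz[of n] by (simp add: \<Phi>_def)

lemma poly_phi_0: "poly (\<phi> n) 0 = \<kappa> n * r n"
  by (simp add: phi_eq poly_0_coeff_0)

lemma poly_phib_0: "poly (\<phi>b n) 0 = \<kappa> n * rb n"
  using kappa_nz[of n] by (simp add: \<Psi>_def poly_0_coeff_0 coeff_reflect_poly degree_phib)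

lemma phi_star_eq: "z \<noteq> 0 \<Longrightarrow> phi_star \<phi>b n z = \<kappa> n * poly (\<Psi> n) z"
  using kappa_nz[of n] by (simp add: \<Psi>_def phi_star_def poly_reflect_poly_nz degree_phib inverse_eq_divide)

end

section \<open>Associated functions\<close>

text \<open>Since (\<zeta> + z) / (\<zeta> - z) = 1 + 2 z / (\<zeta> - z), the associated functions
  reduce to such Cauchy integrals once the contribution of the 1 is dealt with.\<close>

definition cauchy_poly :: "(complex \<Rightarrow> complex) \<Rightarrow> complex poly \<Rightarrow> complex \<Rightarrow> complex" where
  "cauchy_poly w p z = circle_int (\<lambda>\<zeta>. w \<zeta> * inverse (\<zeta> - z) * poly p \<zeta>)"

definition cauchy_poly_inv :: "(complex \<Rightarrow> complex) \<Rightarrow> complex poly \<Rightarrow> complex \<Rightarrow> complex" where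
  "cauchy_poly_inv w q z = circle_int (\<lambda>\<zeta>. w \<zeta> * inverse (\<zeta> - z) * poly q (1 / \<zeta>))"

lemma moments_exist_cmult: "moments_exist f \<Longrightarrow> moments_exist (\<lambda>\<zeta>. c * f \<zeta>)"
  using moments_exist_mult_continuous[of f "\<lambda>_. c"] by (simp add: mult.commute)

lemma moments_exist_add: "moments_exist f \<Longrightarrow> moments_exist g \<Longrightarrow> moments_exist (\<lambda>\<zeta>. f \<zeta> + g \<zeta>)"
  unfolding moments_exist_def by (rule set_integral_add)

text \<open>The identity \<zeta> / (\<zeta> - z) = 1 + z / (\<zeta> - z) strips one degree. It holds
  for z on the circle too, provided that w / (\<zeta> - z) is integrable, so all limits reduce to
  that for the constant polynomial.\<close>

lemma cauchy_poly_pCons: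
  assumes w: "moments_exist w" and wz: "moments_exist (\<lambda>\<zeta>. w \<zeta> * inverse (\<zeta> - z))"
  shows "cauchy_poly w (pCons c p) z = c * circle_int (\<lambda>\<zeta>. w \<zeta> * inverse (\<zeta> - z)) +
    (circle_int (\<lambda>\<zeta>. w \<zeta> * poly p \<zeta>) + z * cauchy_poly w p z)"
proof -
  have p: "continuous_on (sphere 0 1) (poly p)" by (intro continuous_intros)
  note A = moments_exist_cmult[OF wz, of c] and B = moments_exist_mult_continuous[OF w p]
    and C = moments_exist_cmult[OF moments_exist_mult_continuous[OF wz p], of z]
  have "cauchy_poly w (pCons c p) z = circle_int (\<lambda>\<zeta>. c * (w \<zeta> * inverse (\<zeta> - z)) +
      (w \<zeta> * poly p \<zeta> + z * (w \<zeta> * inverse (\<zeta> - z) * poly p \<zeta>)))"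
    unfolding cauchy_poly_def
  proof (rule circle_int_cong[of z])
    fix \<zeta> assume "\<zeta> \<noteq> z"
    then have "inverse (\<zeta> - z) * \<zeta> = 1 + z * inverse (\<zeta> - z)" by (simp add: field_simps)
    then have "w \<zeta> * (inverse (\<zeta> - z) * \<zeta>) * poly p \<zeta> = w \<zeta> * (1 + z * inverse (\<zeta> - z)) * poly p \<zeta>"
      by (simp only:)
    then show "w \<zeta> * inverse (\<zeta> - z) * poly (pCons c p) \<zeta> = c * (w \<zeta> * inverse (\<zeta> - z)) +
      (w \<zeta> * poly p \<zeta> + z * (w \<zeta> * inverse (\<zeta> - z) * poly p \<zeta>))"
      by (simp add: algebra_simps)
  qed
  also have "\<dots> = c * circle_int (\<lambda>\<zeta>. w \<zeta> * inverse (\<zeta> - z)) +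
    (circle_int (\<lambda>\<zeta>. w \<zeta> * poly p \<zeta>) + z * cauchy_poly w p z)"
    unfolding cauchy_poly_def
    by (simp only: circle_int_add[OF A moments_exist_add[OF B C]] circle_int_add[OF B C] circle_int_cmult)
  finally show ?thesis .
qed

text \<open>A power of 1/\<zeta> is stripped by 1 / (\<zeta> (\<zeta> - z)) = (1 / z) (1 / (\<zeta>
  - z) - 1 / \<zeta>).\<close>

lemma cauchy_poly_inv_pCons:
  assumes w: "moments_exist w" and wz: "moments_exist (\<lambda>\<zeta>. w \<zeta> * inverse (\<zeta> - z))" and z: "z \<noteq> 0"
  shows "cauchy_poly_inv w (pCons c p) z = c * circle_int (\<lambda>\<zeta>. w \<zeta> * inverse (\<zeta> - z)) +
    (1 / z * cauchy_poly_inv w p z + - (1 / z) * circle_int (\<lambda>\<zeta>. w \<zeta> * poly (pCons 0 p) (1 / \<zeta>)))"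
proof -
  note A = moments_exist_cmult[OF wz, of c]
    and B = moments_exist_cmult[OF moments_exist_mult_continuous[OF w continuous_on_sphere_poly_inverse], of "- (1 / z)" "pCons 0 p"]
    and C = moments_exist_cmult[OF moments_exist_mult_continuous[OF wz continuous_on_sphere_poly_inverse], of "1 / z" p]
  have "cauchy_poly_inv w (pCons c p) z = circle_int (\<lambda>\<zeta>. c * (w \<zeta> * inverse (\<zeta> - z)) +
      (1 / z * (w \<zeta> * inverse (\<zeta> - z) * poly p (1 / \<zeta>)) + - (1 / z) * (w \<zeta> * poly (pCons 0 p) (1 / \<zeta>))))"
    unfolding cauchy_poly_inv_def
  proof (rule circle_int_cong[of z])
    fix \<zeta> :: complex assume "norm \<zeta> = 1" "\<zeta> \<noteq> z"
    then have "\<zeta> \<noteq> 0" "\<zeta> - z \<noteq> 0" by auto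
    have "inverse (\<zeta> - z) * (1 / \<zeta>) = 1 / z * inverse (\<zeta> - z) - 1 / z * (1 / \<zeta>)"
    proof -
      define y where "y = \<zeta> - z"
      have "y \<noteq> 0" using \<open>\<zeta> - z \<noteq> 0\<close> by (simp add: y_def)
      then have "1 / z * inverse y - 1 / z * (1 / \<zeta>) = (\<zeta> - y) / (z * (y * \<zeta>))"
        using z \<open>\<zeta> \<noteq> 0\<close> by (simp add: field_simps)
      also have "\<zeta> - y = z" by (simp add: y_def)
      also have "z / (z * (y * \<zeta>)) = inverse y * (1 / \<zeta>)" using z by (simp add: inverse_eq_divide)
      finally show ?thesis by (simp add: y_def)
    qed
    then have "w \<zeta> * (inverse (\<zeta> - z) * (1 / \<zeta>)) * poly p (1 / \<zeta>) =
        w \<zeta> * (1 / z * inverse (\<zeta> - z) - 1 / z * (1 / \<zeta>)) * poly p (1 / \<zeta>)" by (simp only:)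
    then show "w \<zeta> * inverse (\<zeta> - z) * poly (pCons c p) (1 / \<zeta>) = c * (w \<zeta> * inverse (\<zeta> - z)) +
      (1 / z * (w \<zeta> * inverse (\<zeta> - z) * poly p (1 / \<zeta>)) + - (1 / z) * (w \<zeta> * poly (pCons 0 p) (1 / \<zeta>)))"
      by (simp add: algebra_simps)
  qed
  also have "\<dots> = c * circle_int (\<lambda>\<zeta>. w \<zeta> * inverse (\<zeta> - z)) +
    (1 / z * cauchy_poly_inv w p z + - (1 / z) * circle_int (\<lambda>\<zeta>. w \<zeta> * poly (pCons 0 p) (1 / \<zeta>)))"
    unfolding cauchy_poly_inv_def
    by (simp only: circle_int_add[OF A moments_exist_add[OF C B]] circle_int_add[OF C B] circle_int_cmult)
  finally show ?thesis .
qed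

lemma moments_exist_cauchy:
  assumes "moments_exist w" "norm z \<noteq> 1"
  shows "moments_exist (\<lambda>\<zeta>. w \<zeta> * inverse (\<zeta> - z))"
  using assms by (intro moments_exist_mult_continuous continuous_intros) auto

lemma cauchy_poly_limit:
  assumes w: "moments_exist w" "moments_exist (\<lambda>\<zeta>. w \<zeta> * inverse (\<zeta> - a))" and a: "a \<noteq> 0"
    and lim: "((\<lambda>z. circle_int (\<lambda>\<zeta>. w \<zeta> * inverse (\<zeta> - z))) \<longlongrightarrow> circle_int (\<lambda>\<zeta>. w \<zeta> * inverse (\<zeta> - a)))
      (at a within - sphere 0 1)"
  shows "(cauchy_poly w p \<longlongrightarrow> cauchy_poly w p a) (at a within - sphere 0 1)"
    and "(cauchy_poly_inv w p \<longlongrightarrow> cauchy_poly_inv w p a) (at a within - sphere 0 1)"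
proof -
  \<comment> \<open>The recursion in 1/\<zeta> divides by z, so 0 has to be avoided as well as the
    circle.\<close>
  have off: "\<forall>\<^sub>F z in at a within - sphere 0 1. norm z \<noteq> 1 \<and> z \<noteq> 0"
  proof (rule eventually_conj)
    show "\<forall>\<^sub>F z in at a within - sphere 0 1. norm z \<noteq> 1" by (auto simp: eventually_at_filter)
    show "\<forall>\<^sub>F z in at a within - sphere 0 1. z \<noteq> 0"
      by (rule tendsto_imp_eventually_ne[OF tendsto_ident_at a])
  qed
  show "(cauchy_poly w p \<longlongrightarrow> cauchy_poly w p a) (at a within - sphere 0 1)"
  proof (induction p)
    case 0
    have "cauchy_poly w 0 = (\<lambda>z. 0)"
      by (rule ext) (simp add: cauchy_poly_def circle_int_eq_integral)
    then show ?case by (simp only: tendsto_const)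
  next
    case (pCons c p)
    have "((\<lambda>z. c * circle_int (\<lambda>\<zeta>. w \<zeta> * inverse (\<zeta> - z)) +
        (circle_int (\<lambda>\<zeta>. w \<zeta> * poly p \<zeta>) + z * cauchy_poly w p z)) \<longlongrightarrow> cauchy_poly w (pCons c p) a)
        (at a within - sphere 0 1)"
      unfolding cauchy_poly_pCons[OF w] by (intro tendsto_intros lim pCons.IH)
    moreover have "\<forall>\<^sub>F z in at a within - sphere 0 1. c * circle_int (\<lambda>\<zeta>. w \<zeta> * inverse (\<zeta> - z)) +
        (circle_int (\<lambda>\<zeta>. w \<zeta> * poly p \<zeta>) + z * cauchy_poly w p z) = cauchy_poly w (pCons c p) z"
      using off
    proof eventually_elim
      case (elim z)
      then show ?case
        by (intro cauchy_poly_pCons[symmetric] moments_exist_cauchy w) auto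
    qed
    ultimately show ?case by (rule Lim_transform_eventually)
  qed
  show "(cauchy_poly_inv w p \<longlongrightarrow> cauchy_poly_inv w p a) (at a within - sphere 0 1)"
  proof (induction p)
    case 0
    have "cauchy_poly_inv w 0 = (\<lambda>z. 0)"
      by (rule ext) (simp add: cauchy_poly_inv_def circle_int_eq_integral)
    then show ?case by (simp only: tendsto_const)
  next
    case (pCons c p)
    have "((\<lambda>z. c * circle_int (\<lambda>\<zeta>. w \<zeta> * inverse (\<zeta> - z)) +
        (1 / z * cauchy_poly_inv w p z + - (1 / z) * circle_int (\<lambda>\<zeta>. w \<zeta> * poly (pCons 0 p) (1 / \<zeta>))))
        \<longlongrightarrow> cauchy_poly_inv w (pCons c p) a) (at a within - sphere 0 1)"
      unfolding cauchy_poly_inv_pCons[OF w a] by (intro tendsto_intros lim pCons.IH a)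
    moreover have "\<forall>\<^sub>F z in at a within - sphere 0 1. c * circle_int (\<lambda>\<zeta>. w \<zeta> * inverse (\<zeta> - z)) +
        (1 / z * cauchy_poly_inv w p z + - (1 / z) * circle_int (\<lambda>\<zeta>. w \<zeta> * poly (pCons 0 p) (1 / \<zeta>)))
        = cauchy_poly_inv w (pCons c p) z"
      using off
    proof eventually_elim
      case (elim z)
      then show ?case
        by (intro cauchy_poly_inv_pCons[symmetric] moments_exist_cauchy w) auto
    qed
    ultimately show ?case by (rule Lim_transform_eventually)
  qed
qed

text \<open>\<open>Lim\<close> is the limit only if that limit is unique, so the filter has to be
  nontrivial; the radial points (1 + e/2) a ensure this.\<close>

lemma circle_value_eq:
  assumes eq: "\<And>z. norm z \<noteq> 1 \<Longrightarrow> f z = g z"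
    and lim: "norm a = 1 \<Longrightarrow> (g \<longlongrightarrow> g a) (at a within - sphere 0 1)"
  shows "circle_value f a = g a"
proof (cases "norm a = 1")
  case True
  have "a islimpt - sphere 0 1"
    unfolding islimpt_approachable
  proof (intro allI impI)
    fix e :: real assume e: "0 < e"
    define b where "b = of_real (1 + e / 2) * a"
    have "norm b = 1 + e / 2" using True e unfolding b_def norm_mult norm_of_real by simp
    moreover have "b - a = of_real (e / 2) * a" by (simp add: b_def algebra_simps)
    then have "dist b a = e / 2" using True e unfolding dist_norm by (simp only: norm_mult norm_of_real)
    ultimately show "\<exists>x'\<in>- sphere 0 1. x' \<noteq> a \<and> dist x' a < e"
      using e True by (intro bexI[of _ b]) auto
  qed
  then have "at a within - sphere 0 1 \<noteq> bot" by (simp add: trivial_limit_within)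
  moreover have "(f \<longlongrightarrow> g a) (at a within - sphere 0 1)"
    using lim[OF True] by (rule Lim_transform_eventually) (auto simp: eventually_at_filter eq)
  ultimately show ?thesis using True by (simp add: circle_value_def tendsto_Lim)
qed (simp add: circle_value_def eq)

context biorthogonal
begin

text \<open>The constant 1 in the kernel contributes the pairing of \<open>\<phi> n\<close> with 1,
  which vanishes only for n \<ge> 1.\<close>

lemma xi_eq:
  assumes n: "1 \<le> n" and z: "norm z \<noteq> 1"
  shows "xi w \<kappa> \<phi> n z = 2 * z * cauchy_poly w (\<phi> n) z"
proof -
  have p: "continuous_on (sphere 0 1) (poly (\<phi> n))" by (intro continuous_intros)
  note B = moments_exist_mult_continuous[OF moments p]
    and C = moments_exist_cmult[OF moments_exist_mult_continuous[OF moments_exist_cauchy[OF moments z] p], of "2 * z"]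
  have "xi w \<kappa> \<phi> n z = circle_int (\<lambda>\<zeta>. w \<zeta> * poly (\<phi> n) \<zeta> + 2 * z * (w \<zeta> * inverse (\<zeta> - z) * poly (\<phi> n) \<zeta>))"
  proof -
    have "circle_int (\<lambda>\<zeta>. (\<zeta> + z) / (\<zeta> - z) * w \<zeta> * poly (\<phi> n) \<zeta>) =
        circle_int (\<lambda>\<zeta>. w \<zeta> * poly (\<phi> n) \<zeta> + 2 * z * (w \<zeta> * inverse (\<zeta> - z) * poly (\<phi> n) \<zeta>))"
    proof (rule circle_int_cong[of z])
      fix \<zeta> assume "\<zeta> \<noteq> z"
      then have "(\<zeta> + z) / (\<zeta> - z) = 1 + 2 * z * inverse (\<zeta> - z)" by (simp add: field_simps)
      then show "(\<zeta> + z) / (\<zeta> - z) * w \<zeta> * poly (\<phi> n) \<zeta> =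
          w \<zeta> * poly (\<phi> n) \<zeta> + 2 * z * (w \<zeta> * inverse (\<zeta> - z) * poly (\<phi> n) \<zeta>)"
        by (simp add: algebra_simps)
    qed
    moreover have "n \<noteq> 0" using n by simp
    ultimately show ?thesis unfolding xi_def by (simp only: if_False)
  qed
  also have "\<dots> = circle_int (\<lambda>\<zeta>. w \<zeta> * poly (\<phi> n) \<zeta>) + 2 * z * cauchy_poly w (\<phi> n) z"
    unfolding cauchy_poly_def by (simp only: circle_int_add[OF B C] circle_int_cmult)
  also have "circle_int (\<lambda>\<zeta>. w \<zeta> * poly (\<phi> n) \<zeta>) = wpair w (\<phi> n) 1" by (simp add: wpair_def)
  also have "\<dots> = 0" using n by (intro wpair_phi_eq_0) auto
  finally show ?thesis by simp
qed

lemma xi_star_eq: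
  assumes z: "norm z \<noteq> 1"
  shows "xi_star w \<kappa> \<phi>b n z = - 2 * z ^ Suc n * cauchy_poly_inv w (\<phi>b n) z"
proof -
  have eq: "circle_int (\<lambda>\<zeta>. (\<zeta> + z) / (\<zeta> - z) * w \<zeta> * poly q (1 / \<zeta>)) = wpair w 1 q + 2 * z * cauchy_poly_inv w q z" for q
  proof -
    note B = moments_exist_mult_continuous[OF moments continuous_on_sphere_poly_inverse, of q]
      and C = moments_exist_cmult[OF moments_exist_mult_continuous[OF moments_exist_cauchy[OF moments z]
        continuous_on_sphere_poly_inverse], of "2 * z" q]
    have "circle_int (\<lambda>\<zeta>. (\<zeta> + z) / (\<zeta> - z) * w \<zeta> * poly q (1 / \<zeta>)) =
        circle_int (\<lambda>\<zeta>. w \<zeta> * poly q (1 / \<zeta>) + 2 * z * (w \<zeta> * inverse (\<zeta> - z) * poly q (1 / \<zeta>)))"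
    proof (rule circle_int_cong[of z])
      fix \<zeta> assume "\<zeta> \<noteq> z"
      then have "(\<zeta> + z) / (\<zeta> - z) = 1 + 2 * z * inverse (\<zeta> - z)" by (simp add: field_simps)
      then show "(\<zeta> + z) / (\<zeta> - z) * w \<zeta> * poly q (1 / \<zeta>) =
          w \<zeta> * poly q (1 / \<zeta>) + 2 * z * (w \<zeta> * inverse (\<zeta> - z) * poly q (1 / \<zeta>))"
        by (simp add: algebra_simps)
    qed
    also have "\<dots> = circle_int (\<lambda>\<zeta>. w \<zeta> * poly q (1 / \<zeta>)) + 2 * z * cauchy_poly_inv w q z"
      unfolding cauchy_poly_inv_def by (simp only: circle_int_add[OF B C] circle_int_cmult)
    finally show ?thesis by (simp add: wpair_def)
  qed
  show ?thesis
  proof (cases "n = 0")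
    case True
    have \<phi>b: "\<phi>b 0 = [:\<kappa> 0:]" using degree_phib[of 0] by (metis degree_0_id)
    \<comment> \<open>The extra summand w_0 in \<xi>*_0 cancels the contribution of the 1 in the
      kernel, so the formula persists at n = 0.\<close>
    have "caratheodory w z = moment w 0 + 2 * z * cauchy_poly_inv w 1 z"
      using eq[of 1] by (simp add: caratheodory_def moment_def wpair_def)
    moreover have "cauchy_poly_inv w (\<phi>b 0) z = \<kappa> 0 * cauchy_poly_inv w 1 z"
      unfolding cauchy_poly_inv_def \<phi>b by (simp add: mult.commute[of _ "\<kappa> 0"] circle_int_cmult)
    ultimately show ?thesis using True by (simp add: xi_star_def)
  next
    case False
    then have "wpair w 1 (\<phi>b n) = 0" by (intro wpair_phi_eq_0) auto
    moreover have "xi_star w \<kappa> \<phi>b n z = - (z ^ n) * circle_int (\<lambda>\<zeta>. (\<zeta> + z) / (\<zeta> - z) * w \<zeta> * poly (\<phi>b n) (1 / \<zeta>))"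
      unfolding xi_star_def using False by (simp only: if_False)
    ultimately show ?thesis unfolding eq by simp
  qed
qed

text \<open>The boundary value at \<open>a\<close> is given by the same formula as off the circle, because \<open>w / (\<zeta> - a)\<close>
  is still integrable.\<close>

lemma circle_value_xi:
  fixes s \<rho> :: "nat \<Rightarrow> complex" and j :: nat
  defines "a \<equiv> s j"
  assumes sc: "regular_semiclassical M s \<rho> w" and j: "j \<le> M" and a: "a \<noteq> 0"
    and wm: "moments_exist (\<lambda>z. inverse (z - a) * w z)"
  shows "1 \<le> n \<Longrightarrow> circle_value (xi w \<kappa> \<phi> n) a = 2 * a * \<kappa> n * wmom (\<lambda>z. inverse (z - a) * w z) 0 (\<Phi> n)"
    and "circle_value (xi_star w \<kappa> \<phi>b n) a
      = - 2 * a * \<kappa> n * (a ^ n * wmom (\<lambda>z. inverse (z - a) * w z) (- int n) (\<Psi> n))"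
proof -
  let ?wm = "\<lambda>z. inverse (z - a) * w z"
  have wa: "moments_exist (\<lambda>\<zeta>. w \<zeta> * inverse (\<zeta> - a))" using wm by (simp add: mult.commute)
  have lim: "(cauchy_poly w p \<longlongrightarrow> cauchy_poly w p a) (at a within - sphere 0 1)"
      "(cauchy_poly_inv w p \<longlongrightarrow> cauchy_poly_inv w p a) (at a within - sphere 0 1)" if "norm a = 1" for p
    using weight_cauchy_limit[OF sc j] that moments wm cauchy_poly_limit[OF moments wa a] unfolding a_def by blast+
  interpret m: moment_functional "wmom ?wm" by (rule moment_functional_wmom[OF wm])
  show "circle_value (xi w \<kappa> \<phi> n) a = 2 * a * \<kappa> n * wmom ?wm 0 (\<Phi> n)" if n: "1 \<le> n"
  proof -
    have "circle_value (xi w \<kappa> \<phi> n) a = 2 * a * cauchy_poly w (\<phi> n) a"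
      by (rule circle_value_eq) (auto intro!: tendsto_intros lim simp: xi_eq[OF n])
    also have "cauchy_poly w (\<phi> n) a = wmom ?wm 0 (\<phi> n)"
      by (simp add: cauchy_poly_def wmom_def mult_ac)
    also have "\<dots> = \<kappa> n * wmom ?wm 0 (\<Phi> n)" by (simp add: phi_eq m.L_smult)
    finally show ?thesis by simp
  qed
  have "circle_value (xi_star w \<kappa> \<phi>b n) a = - 2 * a ^ Suc n * cauchy_poly_inv w (\<phi>b n) a"
    by (rule circle_value_eq) (auto intro!: tendsto_intros lim simp: xi_star_eq simp del: power_Suc)
  also have "cauchy_poly_inv w (\<phi>b n) a = wpair ?wm 1 (\<phi>b n)"
    by (simp add: cauchy_poly_inv_def wpair_def mult_ac)
  \<comment> \<open>Reversal with k = n turns the pairing with 1 into index -n;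
    \<open>L_0_Psi\<close> later brings this back to index 0.\<close>
  also have "\<dots> = wmom ?wm (- int n) (reflect_poly (\<phi>b n))"
    by (subst wmom_reflect_poly) (simp_all add: degree_phib)
  also have "\<dots> = \<kappa> n * wmom ?wm (- int n) (\<Psi> n)"
    using kappa_nz[of n] by (simp add: \<Psi>_def m.L_smult)
  finally show "circle_value (xi_star w \<kappa> \<phi>b n) a = - 2 * a * \<kappa> n * (a ^ n * wmom ?wm (- int n) (\<Psi> n))"
    by (simp add: mult_ac)
qed

lemma K_matrix_eq:
  "K_matrix \<kappa> \<phi> \<phi>b n z = (\<kappa> (Suc n) / \<kappa> n) \<cdot>\<^sub>m mat2 z (r (Suc n)) (rb (Suc n) * z) 1"
  unfolding K_matrix_def mat2_def
  by (rule eq_matI) (auto simp: mat_of_rows_list_def poly_phi_0 poly_phib_0 less_Suc_eq numeral_2_eq_2)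

lemma R_plus_eq:
  assumes "a \<noteq> 0"
  shows "R_plus a \<kappa>' \<kappa> \<phi> \<phi>b n z = (1 / (z - a) * (\<kappa>' n / \<kappa> n)) \<cdot>\<^sub>m
    mat2 (z - poly (\<Phi> (Suc n)) a / poly (\<Phi> n) a) (r (Suc n)) (poly (\<Psi> n) a / poly (\<Phi> n) a * z) (- a)"
  unfolding R_plus_def using kappa_nz[of n] kappa_nz[of "Suc n"] assms
  by (simp add: poly_phi_0 phi_star_eq) (simp add: phi_eq)

end

section \<open>Compatibility\<close>

text \<open>The entries (1,1), (1,2), (2,1), (2,2) of the two matrix products without scalar
  prefactors; the relations of \<open>compat_christoffel\<close> match their coefficients in
  z.\<close>

lemma christoffel_entries:
  fixes a :: "'a::field"
  assumes "srb = \<beta>'" and "r' - \<alpha>' * r = - a * sr" and "\<beta>' * \<alpha> = \<beta> + a * rb" and "r' * rb - \<alpha>' = sr * \<beta> - \<alpha>"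
  shows "(z - \<alpha>') * z + r' * (rb * z) = z * (z - \<alpha>) + sr * (\<beta> * z)"
    and "(z - \<alpha>') * r + r' * 1 = z * r + sr * (- a)"
    and "\<beta>' * z * z + - a * (rb * z) = srb * z * (z - \<alpha>) + 1 * (\<beta> * z)"
    and "\<beta>' * z * r + - a * 1 = srb * z * r + 1 * (- a)"
  subgoal using assms(4) by Groebner_Basis.algebra
  subgoal using assms(2) by Groebner_Basis.algebra
  subgoal unfolding assms(1) using assms(3) by Groebner_Basis.algebra
  subgoal using assms(1) by simp
  done

text \<open>The same four entries for \<open>R_minus\<close>, with t standing for z / a to avoid
  division. Letters with \<open>s\<close> belong to the given weight, and primes mark the next
  index.\<close>

lemma geronimus_entries:
  fixes a :: "'a::field"
  assumes "a \<noteq> 0" and "a * q = r' * p" and "p + sb * q = 1" and "p' + sb' * q' = 1" and "p' * sr' + q' = r'"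
    and "a * sb' = p * (a * rb' + sb)" and "p' * (sb' * sr' - 1) = rb' * a * q - p" and "z = a * t"
  shows "p' * z + q' * (sb' * z) = z * p + r' * (sb * p * t)"
    and "p' * sr' + q' * 1 = z * q + r' * (1 - p * t)"
    and "sb' * p' * t * z + (1 - p' * t) * (sb' * z) = rb' * z * p + 1 * (sb * p * t)"
    and "sb' * p' * t * sr' + (1 - p' * t) * 1 = rb' * z * q + 1 * (1 - p * t)"
  subgoal using assms(2,3,4,8) by Groebner_Basis.algebra
  subgoal using assms(2,5,8) by Groebner_Basis.algebra
  subgoal using assms(6,8) by Groebner_Basis.algebra
  subgoal using assms(7,8) by Groebner_Basis.algebra
  done

lemma smult_mat2_mult:
  "(x \<cdot>\<^sub>m mat2 a b c d) * (y \<cdot>\<^sub>m mat2 a' b' c' d') =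
    (x * y) \<cdot>\<^sub>m mat2 (a * a' + b * c') (a * b' + b * d') (c * a' + d * c') (c * b' + d * d')"
  unfolding mat2_def
  by (rule eq_matI) (auto simp: mat_of_rows_list_def less_Suc_eq numeral_2_eq_2 scalar_prod_def algebra_simps)

text \<open>\<open>w'\<close> is constrained off \<open>a\<close> only, so that the lemma also
  applies in the - case, where (\<zeta> - a) * inverse (\<zeta> - a) * w is 0 at \<open>a\<close>
  whatever the weight is there.\<close>

lemma wmom_linear_factor:
  assumes w: "moments_exist w" and w': "\<And>\<zeta>. norm \<zeta> = 1 \<Longrightarrow> \<zeta> \<noteq> a \<Longrightarrow> w' \<zeta> = (\<zeta> - a) * w \<zeta>"
  shows "wmom w' k p = wmom w (k + 1) p - a * wmom w k p"
proof -
  have "wmom w' k p = circle_int (\<lambda>\<zeta>. w \<zeta> * (\<zeta> powi (k + 1) * poly p \<zeta> + - a * (\<zeta> powi k * poly p \<zeta>)))"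
    unfolding wmom_def
  proof (rule circle_int_cong[of a])
    fix \<zeta> :: complex assume "norm \<zeta> = 1" "\<zeta> \<noteq> a"
    moreover from this have "\<zeta> \<noteq> 0" by auto
    ultimately show "w' \<zeta> * (\<zeta> powi k * poly p \<zeta>) = w \<zeta> * (\<zeta> powi (k + 1) * poly p \<zeta> + - a * (\<zeta> powi k * poly p \<zeta>))"
      by (simp add: w' power_int_add algebra_simps)
  qed
  also have "\<dots> = wmom w (k + 1) p + - a * wmom w k p"
    unfolding wmom_def circle_int_weight_cmult[symmetric]
    by (intro circle_int_weight_add w continuous_on_mult continuous_on_sphere_powi continuous_intros)
  finally show ?thesis by simp
qed

lemma schlesinger_compatible_plus:
  assumes B: "biorthogonal_system w \<kappa> \<phi> \<phi>b" and B': "biorthogonal_system (\<lambda>z. (z - a) * w z) \<kappa>p \<phi>p \<phi>bp"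
    and a: "a \<noteq> 0" and nz: "\<And>n. poly (\<phi> n) a \<noteq> 0"
  shows "R_plus a \<kappa>p \<kappa> \<phi> \<phi>b (n+1) z * K_matrix \<kappa> \<phi> \<phi>b n z = K_matrix \<kappa>p \<phi>p \<phi>bp n z * R_plus a \<kappa>p \<kappa> \<phi> \<phi>b n z"
proof -
  interpret W: biorthogonal w \<kappa> \<phi> \<phi>b by standard (rule B)
  interpret P: biorthogonal "\<lambda>z. (z - a) * w z" \<kappa>p \<phi>p \<phi>bp by standard (rule B')
  interpret christoffel "wmom w" "wmom (\<lambda>z. (z - a) * w z)" W.\<Phi> W.\<Psi> P.\<Phi> P.\<Psi> a
    by standard (use a in \<open>auto intro!: wmom_linear_factor W.moments\<close>)
  have nz': "poly (W.\<Phi> m) a \<noteq> 0" for m using nz[of m] by (simp add: W.phi_eq)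
  define \<alpha> where "\<alpha> m = poly (W.\<Phi> (Suc m)) a / poly (W.\<Phi> m) a" for m
  define \<beta> where "\<beta> m = poly (W.\<Psi> m) a / poly (W.\<Phi> m) a" for m
  note c = compat_christoffel[OF nz', of n, folded \<alpha>_def \<beta>_def]
  note entries = christoffel_entries[OF c, of z]
  \<comment> \<open>\<kappa>_{n+1} cancels on the left and the shifted \<kappa>_n on the right,
    leaving equal prefactors.\<close>
  have scal: "1 / (z - a) * (\<kappa>p (Suc n) / \<kappa> (Suc n)) * (\<kappa> (Suc n) / \<kappa> n) = \<kappa>p (Suc n) / \<kappa>p n * (1 / (z - a) * (\<kappa>p n / \<kappa> n))"
    using W.kappa_nz P.kappa_nz by simp
  show ?thesis
    unfolding Suc_eq_plus1[symmetric] W.R_plus_eq[OF a] W.K_matrix_eq P.K_matrix_eq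
      \<alpha>_def[symmetric] \<beta>_def[symmetric] smult_mat2_mult scal entries ..
qed

lemma schlesinger_compatible_minus:
  fixes s \<rho> :: "nat \<Rightarrow> complex" and j :: nat
  defines "a \<equiv> s j"
  assumes sc: "regular_semiclassical M s \<rho> w" "j \<le> M" and a: "a \<noteq> 0"
    and B: "biorthogonal_system w \<kappa> \<phi> \<phi>b" and B': "biorthogonal_system (\<lambda>z. inverse (z - a) * w z) \<kappa>m \<phi>m \<phi>bm"
    and nz: "\<And>n. circle_value (xi_star w \<kappa> \<phi>b n) a \<noteq> 0" and n: "1 \<le> n"
  shows "R_minus w a \<kappa>m \<kappa> \<phi> \<phi>b (n+1) z * K_matrix \<kappa> \<phi> \<phi>b n z
    = K_matrix \<kappa>m \<phi>m \<phi>bm n z * R_minus w a \<kappa>m \<kappa> \<phi> \<phi>b n z"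
proof -
  let ?wm = "\<lambda>z. inverse (z - a) * w z"
  interpret W: biorthogonal w \<kappa> \<phi> \<phi>b by standard (rule B)
  interpret Q: biorthogonal ?wm \<kappa>m \<phi>m \<phi>bm by standard (rule B')
  \<comment> \<open>The roles are interchanged: the divided weight is \<open>L\<close>, and the
    primed polynomials of the locale are those of \<open>w\<close>.\<close>
  interpret christoffel "wmom ?wm" "wmom w" Q.\<Phi> Q.\<Psi> W.\<Phi> W.\<Psi> a
    by standard (use a in \<open>auto intro!: wmom_linear_factor Q.moments\<close>)
  define u where "u m = wmom ?wm 0 (W.\<Phi> m)" for m
  define v where "v m = wmom ?wm 0 (W.\<Psi> m)" for m
  have X: "1 \<le> m \<Longrightarrow> circle_value (xi w \<kappa> \<phi> m) a = 2 * a * \<kappa> m * u m"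
    and X': "circle_value (xi_star w \<kappa> \<phi>b m) a = - 2 * a * \<kappa> m * v m" for m
    using W.circle_value_xi[OF sc, folded a_def, OF a Q.moments, of m] unfolding u_def v_def L_0_Psi by auto
  have v_nz: "v m \<noteq> 0" for m using nz[of m] unfolding X' by auto
  have nd: "W.r (Suc m) * W.rb (Suc m) \<noteq> 1" for m using W.kappa_Suc[of m] W.kappa_nz[of m] by auto
  define p where "p m = v (Suc m) / (v m * (1 - W.r (Suc m) * W.rb (Suc m)))" for m
  define q where "q m = - u (Suc m) / (v m * (1 - W.r (Suc m) * W.rb (Suc m)))" for m
  note c = compat_geronimus[OF v_nz[unfolded v_def] nd, folded u_def v_def, folded p_def q_def]
  have ratio: "(\<kappa> (Suc m))\<^sup>2 / (\<kappa> m)\<^sup>2 = 1 / (1 - W.r (Suc m) * W.rb (Suc m))" for m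
    using W.kappa_Suc[of m] W.kappa_nz[of m] nd[of m] by (simp add: field_simps)
  \<comment> \<open>The factors -2 a cancel, and \<kappa>_{m+1}^2 / \<kappa>_m^2 supplies 1 / (1 - r
    rb).\<close>
  have p_eq: "\<kappa> (Suc m) * (- 2 * a * \<kappa> (Suc m) * v (Suc m)) / (\<kappa> m * (- 2 * a * \<kappa> m * v m)) = p m" for m
  proof -
    have "\<kappa> (Suc m) * (- 2 * a * \<kappa> (Suc m) * v (Suc m)) / (\<kappa> m * (- 2 * a * \<kappa> m * v m))
        = (\<kappa> (Suc m))\<^sup>2 / (\<kappa> m)\<^sup>2 * (v (Suc m) / v m)"
      using a by (simp add: power2_eq_square mult.assoc)
    then show ?thesis unfolding ratio by (simp add: p_def)
  qed
  \<comment> \<open>\<xi> and \<xi>* carry opposite signs, whence the minus in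
    \<open>q\<close>.\<close>
  have q_eq: "\<kappa> (Suc m) * (2 * a * \<kappa> (Suc m) * u (Suc m)) / (\<kappa> m * (- 2 * a * \<kappa> m * v m)) = q m" for m
  proof -
    have "\<kappa> (Suc m) * (2 * a * \<kappa> (Suc m) * u (Suc m)) / (\<kappa> m * (- 2 * a * \<kappa> m * v m))
        = (\<kappa> (Suc m))\<^sup>2 / (\<kappa> m)\<^sup>2 * (- u (Suc m) / v m)"
      using a by (simp add: power2_eq_square mult.assoc)
    then show ?thesis unfolding ratio by (simp add: q_def)
  qed
  have R: "R_minus w a \<kappa>m \<kappa> \<phi> \<phi>b (Suc m) z = (\<kappa>m (Suc m) / \<kappa> (Suc m)) \<cdot>\<^sub>m
      mat2 (p m) (q m) (W.rb (Suc m) * p m * (z / a)) (1 - p m * (z / a))" for m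
  proof -
    have "poly (\<phi>b (Suc m)) 0 * (- 2 * a * \<kappa> (Suc m) * v (Suc m)) / (\<kappa> m * (- 2 * a * \<kappa> m * v m)) = W.rb (Suc m) * p m"
      unfolding p_eq[symmetric] W.poly_phib_0 by simp
    then show ?thesis
      unfolding R_minus_def Let_def by (simp only: X[of "Suc m", simplified] X' diff_Suc_1 p_eq q_eq)
  qed
  \<comment> \<open>\<open>R_minus\<close> at index n corresponds to \<open>p\<close> and
    \<open>q\<close> at n - 1, so the two products involve the indices m and m + 1.\<close>
  obtain m where m: "n = Suc m" using n by (cases n) auto
  have "z = a * (z / a)" using a by simp
  note entries = geronimus_entries[OF a c(1)[of m] c(2)[of m] c(2)[of "Suc m"] c(3)[of "Suc m"] c(4)[of m] c(5)[of m] this]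
  have scal: "\<kappa>m (Suc (Suc m)) / \<kappa> (Suc (Suc m)) * (\<kappa> (Suc (Suc m)) / \<kappa> (Suc m))
      = \<kappa>m (Suc (Suc m)) / \<kappa>m (Suc m) * (\<kappa>m (Suc m) / \<kappa> (Suc m))"
    using W.kappa_nz Q.kappa_nz by simp
  show ?thesis
    unfolding m Suc_eq_plus1[symmetric] R W.K_matrix_eq Q.K_matrix_eq smult_mat2_mult scal entries ..
qed

theorem proposition5p4:
  fixes M j :: nat
    and s \<rho> :: "nat \<Rightarrow> complex"
    and w :: "complex \<Rightarrow> complex"
    and \<kappa> \<kappa>p \<kappa>m :: "nat \<Rightarrow> complex"
    and \<phi> \<phi>b \<phi>p \<phi>bp \<phi>m \<phi>bm :: "nat \<Rightarrow> complex poly"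
  assumes "regular_semiclassical M s \<rho> w"
    and "j \<le> M" and "s j \<noteq> 0"
    and "biorthogonal_system w \<kappa> \<phi> \<phi>b" and "nondegenerate \<kappa> \<phi> \<phi>b"
  shows
    "(biorthogonal_system (\<lambda>z. (z - s j) * w z) \<kappa>p \<phi>p \<phi>bp \<and> nondegenerate \<kappa>p \<phi>p \<phi>bp \<and>
      (\<forall>n. poly (\<phi> n) (s j) \<noteq> 0) \<longrightarrow>
        (\<forall>n z. z \<noteq> s j \<longrightarrow>
           R_plus (s j) \<kappa>p \<kappa> \<phi> \<phi>b (n+1) z * K_matrix \<kappa> \<phi> \<phi>b n z
             = K_matrix \<kappa>p \<phi>p \<phi>bp n z * R_plus (s j) \<kappa>p \<kappa> \<phi> \<phi>b n z))
     \<and>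
     (biorthogonal_system (\<lambda>z. inverse (z - s j) * w z) \<kappa>m \<phi>m \<phi>bm \<and> nondegenerate \<kappa>m \<phi>m \<phi>bm \<and>
      (\<forall>n. circle_value (xi_star w \<kappa> \<phi>b n) (s j) \<noteq> 0) \<longrightarrow>
        (\<forall>n\<ge>1. \<forall>z.
           R_minus w (s j) \<kappa>m \<kappa> \<phi> \<phi>b (n+1) z * K_matrix \<kappa> \<phi> \<phi>b n z
             = K_matrix \<kappa>m \<phi>m \<phi>bm n z * R_minus w (s j) \<kappa>m \<kappa> \<phi> \<phi>b n z))"
proof (intro conjI impI allI)
  fix n :: nat and z :: complex
  assume "biorthogonal_system (\<lambda>z. (z - s j) * w z) \<kappa>p \<phi>p \<phi>bp \<and> nondegenerate \<kappa>p \<phi>p \<phi>bp \<and>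
      (\<forall>n. poly (\<phi> n) (s j) \<noteq> 0)"
  then show "R_plus (s j) \<kappa>p \<kappa> \<phi> \<phi>b (n+1) z * K_matrix \<kappa> \<phi> \<phi>b n z
      = K_matrix \<kappa>p \<phi>p \<phi>bp n z * R_plus (s j) \<kappa>p \<kappa> \<phi> \<phi>b n z"
    using assms(3,4) by (intro schlesinger_compatible_plus) auto
next
  fix n :: nat and z :: complex
  assume "biorthogonal_system (\<lambda>z. inverse (z - s j) * w z) \<kappa>m \<phi>m \<phi>bm \<and> nondegenerate \<kappa>m \<phi>m \<phi>bm \<and>
      (\<forall>n. circle_value (xi_star w \<kappa> \<phi>b n) (s j) \<noteq> 0)" and "1 \<le> n"
  then show "R_minus w (s j) \<kappa>m \<kappa> \<phi> \<phi>b (n+1) z * K_matrix \<kappa> \<phi> \<phi>b n z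
      = K_matrix \<kappa>m \<phi>m \<phi>bm n z * R_minus w (s j) \<kappa>m \<kappa> \<phi> \<phi>b n z"
    using assms(1-4) by (intro schlesinger_compatible_minus[OF assms(1,2)]) auto
qed

end
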